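(* Let $K$ be a finite field with $|K|=q$ elements and $\mathrm{char}(K)\neq 2$, and let $T_{\mathrm{Cla}}(UJ_2)\subseteq J(X)$ be the set of all $\mathbb{Z}_2$-graded polynomial identities of $UJ_2=UJ_2(K)$ endowed with the classical grading. Let $I'$ be the $T_{\mathbb{Z}_2}$-ideal of $J(X)$ generated by the polynomials \[(y_1,y_2,y_3),\quad z_1z_2,\quad (y_1,z_1,y_2),\quad y_1^q-y_1.\] Then $I'=T_{\mathrm{Cla}}(UJ_2)$. Moreover, let $\widehat{S}\subseteq J(X)$ be the set of all polynomials of the forms (a) $Y_1'$, (b) $Y_1'(z_iY_2')$, where $r\geq 1$; $Y_1'=y_1^{k_1}\cdots y_r^{k_r}$ with $0\leq k_1,\ldots,k_r<q$; $Y_2'=y_1^{l_1}\cdots y_r^{l_r}$ with $0\leq l_1,\ldots,l_r<q$; $Y_1'\leq Y_2'$ in (b); and $z_i\in Z$. Then the elements $g+I'$, $g\in\widehat{S}$, form a basis of the quotient vector space $J(X)/I'$.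
   Context: $UT_2(K)$ is the associative algebra of $2\times 2$ upper triangular matrices over $K$ with usual product $\cdot$, and $UJ_2=UJ_2(K)$ is the same vector space with the Jordan product $u\circ v=\frac12(u\cdot v+v\cdot u)$, written $uv$. A $\mathbb{Z}_2$-grading is a decomposition $UJ_2=(UJ_2)_0\oplus (UJ_2)_1$ with $(UJ_2)_i\circ(UJ_2)_j\subseteq (UJ_2)_{i+j}$. The classical grading is $(UJ_2)_0=\mathrm{span}\{e_{11}+e_{22},e_{11}-e_{22}\}$, $(UJ_2)_1=\mathrm{span}\{e_{12}\}$, where $e_{ij}$ are matrix units. $Y=\{y_1,y_2,\ldots\}$ and $Z=\{z_1,z_2,\ldots\}$ are disjoint infinite sets, $X=Y\cup Z$, and $J(X)$ is the free (unital) Jordan algebra over $K$ freely generated by $X$, with the $\mathbb{Z}_2$-grading in which each $y_i$ is even (degree $0$), each $z_i$ is odd (degree $1$), and the degree of a product of monomials is the sum of the degrees modulo $2$. A $T_{\mathbb{Z}_2}$-ideal is an ideal of $J(X)$ closed under all $\mathbb{Z}_2$-graded endomorphisms of $J(X)$; the $T_{\mathbb{Z}_2}$-ideal generated by a set is the smallest one containing it. An element $f(y_1,\ldots,y_s,z_1,\ldots,z_n)\in J(X)$ is a $\mathbb{Z}_2$-graded polynomial identity of $UJ_2$ if it vanishes under all substitutions of elements of $(UJ_2)_0$ for the $y_i$ and of elements of $(UJ_2)_1$ for the $z_i$. Associator: $(u,v,w)=(uv)w-u(vw)$. Products and powers without parentheses are left-normed: $f_1f_2\cdots f_n=(f_1\cdots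 f_{n-1})f_n$; the empty product is $1$. Order: for monomials $Y'=y_{i_1}\cdots y_{i_r}$ and $Y''=y_{j_1}\cdots y_{j_s}$ (variables listed with multiplicity) with $r,s\geq 0$, $i_1\leq\cdots\leq i_r$, $j_1\leq\cdots\leq j_s$, write $Y'<Y''$ if either $r<s$, or $r=s$ and for some $l$ one has $i_1=j_1,\ldots,i_l=j_l$ and $i_{l+1}<j_{l+1}$; $Y'\leq Y''$ means $Y'<Y''$ or $Y'=Y''$. *)

theory Defs
  imports "HOL-Analysis.Analysis" "HOL-Library.Z2"
begin

section \<open>Unital Jordan algebras\<close>

locale unital_jordan_algebra = vector_space scale
  for scale :: "'k::field \<Rightarrow> 'a::ab_group_add \<Rightarrow> 'a" +
  fixes mult :: "'a \<Rightarrow> 'a \<Rightarrow> 'a" and unit :: 'a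
  assumes mult_commute: "mult u v = mult v u"
    and mult_add_left: "mult (u + v) w = mult u w + mult v w"
    and mult_scale_left: "mult (scale c u) v = scale c (mult u v)"
    and mult_unit_left: "mult unit u = u"
    and jordan_identity: "mult (mult (mult u u) v) u = mult (mult u u) (mult v u)"

definition unital_alg_hom ::
  "('k::field \<Rightarrow> 'a::ab_group_add \<Rightarrow> 'a) \<Rightarrow> ('a \<Rightarrow> 'a \<Rightarrow> 'a) \<Rightarrow> 'a \<Rightarrow>
   ('k \<Rightarrow> 'b::ab_group_add \<Rightarrow> 'b) \<Rightarrow> ('b \<Rightarrow> 'b \<Rightarrow> 'b) \<Rightarrow> 'b \<Rightarrow> ('a \<Rightarrow> 'b) \<Rightarrow> bool"
where
  "unital_alg_hom sc mu e sc' mu' e' \<phi> \<longleftrightarrow>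
     Vector_Spaces.linear sc sc' \<phi> \<and>
     (\<forall>f g. \<phi> (mu f g) = mu' (\<phi> f) (\<phi> g)) \<and> \<phi> e = e'"


section \<open>The free unital Jordan algebra\<close>

text \<open>
  \<open>J(X)\<close> is the term algebra over \<open>X = Y \<union> Z\<close> modulo the equational theory of unital Jordan
  algebras over \<open>'k\<close>. Indices start at 0: the variable written \<open>y\<^sub>i\<close> (resp. \<open>z\<^sub>i\<close>), \<open>i \<ge> 1\<close>, in the
  mathematical text is the one with index \<open>i - 1\<close> here.
\<close>

datatype 'k jterm =
  TY nat | TZ nat | TOne | TZero
  | TAdd "'k jterm" "'k jterm" | TScale 'k "'k jterm" | TMult "'k jterm" "'k jterm"

inductive jeq :: "'k::field jterm \<Rightarrow> 'k jterm \<Rightarrow> bool" where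
  refl: "jeq s s"
| sym: "jeq s t \<Longrightarrow> jeq t s"
| trans: "jeq s t \<Longrightarrow> jeq t u \<Longrightarrow> jeq s u"
| cong_add: "jeq s s' \<Longrightarrow> jeq t t' \<Longrightarrow> jeq (TAdd s t) (TAdd s' t')"
| cong_scale: "jeq s s' \<Longrightarrow> jeq (TScale c s) (TScale c s')"
| cong_mult: "jeq s s' \<Longrightarrow> jeq t t' \<Longrightarrow> jeq (TMult s t) (TMult s' t')"
| add_assoc: "jeq (TAdd (TAdd s t) u) (TAdd s (TAdd t u))"
| add_commute: "jeq (TAdd s t) (TAdd t s)"
| add_zero: "jeq (TAdd TZero s) s"
| add_inverse: "jeq (TAdd (TScale (-1) s) s) TZero"
| scale_add_right: "jeq (TScale c (TAdd s t)) (TAdd (TScale c s) (TScale c t))"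
| scale_add_left: "jeq (TScale (c + d) s) (TAdd (TScale c s) (TScale d s))"
| scale_scale: "jeq (TScale c (TScale d s)) (TScale (c * d) s)"
| scale_one: "jeq (TScale 1 s) s"
| mult_commute: "jeq (TMult s t) (TMult t s)"
| mult_add_left: "jeq (TMult (TAdd s t) u) (TAdd (TMult s u) (TMult t u))"
| mult_scale_left: "jeq (TMult (TScale c s) t) (TScale c (TMult s t))"
| mult_one_left: "jeq (TMult TOne s) s"
| jordan: "jeq (TMult (TMult (TMult s s) t) s) (TMult (TMult s s) (TMult t s))"

lemma equivp_jeq: "equivp jeq"
  by (intro equivpI reflpI sympI transpI) (blast intro: jeq.refl jeq.sym jeq.trans)+

quotient_type (overloaded) 'k free_jordan = "'k::field jterm" / jeq
  by (rule equivp_jeq)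

instantiation free_jordan :: (field) "{ab_group_add, one, times}"
begin
lift_definition zero_free_jordan :: "'a free_jordan" is TZero .
lift_definition one_free_jordan :: "'a free_jordan" is TOne .
lift_definition plus_free_jordan :: "'a free_jordan \<Rightarrow> 'a free_jordan \<Rightarrow> 'a free_jordan"
  is TAdd by (rule jeq.cong_add)
lift_definition times_free_jordan :: "'a free_jordan \<Rightarrow> 'a free_jordan \<Rightarrow> 'a free_jordan"
  is TMult by (rule jeq.cong_mult)
lift_definition uminus_free_jordan :: "'a free_jordan \<Rightarrow> 'a free_jordan"
  is "TScale (-1)" by (rule jeq.cong_scale)
lift_definition minus_free_jordan :: "'a free_jordan \<Rightarrow> 'a free_jordan \<Rightarrow> 'a free_jordan"
  is "\<lambda>s t. TAdd s (TScale (-1) t)" by (intro jeq.cong_add jeq.cong_scale)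
instance
  by standard (transfer, blast intro: jeq.intros)+
end

lift_definition scaleJ :: "'k::field \<Rightarrow> 'k free_jordan \<Rightarrow> 'k free_jordan" (infixr \<open>*J\<close> 75)
  is TScale by (rule jeq.cong_scale)

lift_definition yv :: "nat \<Rightarrow> 'k::field free_jordan" is TY .
lift_definition zv :: "nat \<Rightarrow> 'k::field free_jordan" is TZ .

global_interpretation FJ: unital_jordan_algebra scaleJ "(*)" "1 :: 'k::field free_jordan"
  by unfold_locales (transfer, blast intro: jeq.intros)+

primrec jeval ::
  "('k \<Rightarrow> 'a::ab_group_add \<Rightarrow> 'a) \<Rightarrow> ('a \<Rightarrow> 'a \<Rightarrow> 'a) \<Rightarrow> 'a \<Rightarrow>
   (nat \<Rightarrow> 'a) \<Rightarrow> (nat \<Rightarrow> 'a) \<Rightarrow> 'k jterm \<Rightarrow> 'a" where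
  "jeval sc mu e a b (TY i) = a i"
| "jeval sc mu e a b (TZ i) = b i"
| "jeval sc mu e a b TOne = e"
| "jeval sc mu e a b TZero = 0"
| "jeval sc mu e a b (TAdd s t) = jeval sc mu e a b s + jeval sc mu e a b t"
| "jeval sc mu e a b (TScale c s) = sc c (jeval sc mu e a b s)"
| "jeval sc mu e a b (TMult s t) = mu (jeval sc mu e a b s) (jeval sc mu e a b t)"

context unital_jordan_algebra
begin

lemma jeval_cong: "jeq s t \<Longrightarrow> jeval scale mult unit a b s = jeval scale mult unit a b t"
  by (induction rule: jeq.induct)
     (simp_all add: mult_add_left mult_scale_left mult_unit_left jordan_identity
        scale_right_distrib scale_left_distrib add_ac,
      rule mult_commute)

text \<open>The universal property: substitutions of elements for the variables correspond to
  homomorphisms.\<close>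

theorem free_jordan_universal:
  "\<exists>!\<phi>. unital_alg_hom scaleJ (*) 1 scale mult unit \<phi> \<and>
        (\<forall>i. \<phi> (yv i) = a i) \<and> (\<forall>i. \<phi> (zv i) = b i)"
proof (rule ex1I)
  define \<phi> where "\<phi> f = jeval scale mult unit a b (rep_free_jordan f)" for f
  have \<phi>: "\<phi> (abs_free_jordan t) = jeval scale mult unit a b t" for t
    unfolding \<phi>_def
    by (rule jeval_cong) (metis Quotient_free_jordan Quotient_rep_abs jeq.refl)
  have "\<phi> (f + g) = \<phi> f + \<phi> g" "\<phi> (c *J f) = scale c (\<phi> f)"
    "\<phi> (f * g) = mult (\<phi> f) (\<phi> g)" for f g c
    by (induction f, induction g,
        simp add: \<phi> plus_free_jordan.abs_eq scaleJ.abs_eq times_free_jordan.abs_eq)+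
  then show "unital_alg_hom scaleJ (*) 1 scale mult unit \<phi> \<and>
      (\<forall>i. \<phi> (yv i) = a i) \<and> (\<forall>i. \<phi> (zv i) = b i)"
    unfolding unital_alg_hom_def
    by (auto intro!: Vector_Spaces.linear.intro module_hom.intro module_hom_axioms.intro
        FJ.vector_space_axioms vector_space_axioms FJ.module_axioms module_axioms
        simp: \<phi> one_free_jordan.abs_eq yv.abs_eq zv.abs_eq)
  fix \<psi>
  assume \<psi>: "unital_alg_hom scaleJ (*) 1 scale mult unit \<psi> \<and>
      (\<forall>i. \<psi> (yv i) = a i) \<and> (\<forall>i. \<psi> (zv i) = b i)"
  then interpret lin: Vector_Spaces.linear scaleJ scale \<psi>
    by (simp add: unital_alg_hom_def)
  have "\<psi> (abs_free_jordan t) = jeval scale mult unit a b t" for t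
  proof (induction t)
    case TZero
    then show ?case using lin.zero by (simp add: zero_free_jordan_def)
  next
    case (TAdd s t)
    then show ?case using lin.add[of "abs_free_jordan s" "abs_free_jordan t"]
      by (simp add: plus_free_jordan.abs_eq)
  next
    case (TScale c s)
    then show ?case using lin.scale[of c "abs_free_jordan s"]
      by (simp add: scaleJ.abs_eq)
  next
    case (TMult s t)
    then show ?case using \<psi> unfolding unital_alg_hom_def
      by (metis times_free_jordan.abs_eq jeval.simps(7))
  qed (use \<psi> in \<open>auto simp: unital_alg_hom_def yv_def zv_def one_free_jordan_def\<close>)
  then have "\<psi> f = \<phi> f" for f
    by (induction f) (simp add: \<phi>)
  then show "\<psi> = \<phi>" by blast
qed

end

definition assoc :: "'k::field free_jordan \<Rightarrow> 'k free_jordan \<Rightarrow> 'k free_jordan \<Rightarrow> 'k free_jordan"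
  where "assoc u v w = (u * v) * w - u * (v * w)"

text \<open>Left-normed products and powers.\<close>

definition lprod :: "'k::field free_jordan list \<Rightarrow> 'k free_jordan"
  where "lprod fs = foldl (*) 1 fs"

definition lpow :: "'k::field free_jordan \<Rightarrow> nat \<Rightarrow> 'k free_jordan"
  where "lpow f n = lprod (replicate n f)"


section \<open>The grading of the free Jordan algebra and T-ideals\<close>

inductive monomial_deg :: "bit \<Rightarrow> 'k::field free_jordan \<Rightarrow> bool" where
  one: "monomial_deg 0 1"
| even: "monomial_deg 0 (yv i)"
| odd: "monomial_deg 1 (zv i)"
| mult: "monomial_deg d u \<Longrightarrow> monomial_deg e v \<Longrightarrow> monomial_deg (d + e) (u * v)"

definition J_comp :: "bit \<Rightarrow> 'k::field free_jordan set"
  where "J_comp d = FJ.span {u. monomial_deg d u}"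

definition graded_endo :: "('k::field free_jordan \<Rightarrow> 'k free_jordan) \<Rightarrow> bool"
  where "graded_endo \<phi> \<longleftrightarrow>
    unital_alg_hom scaleJ (*) 1 scaleJ (*) 1 \<phi> \<and> (\<forall>d. \<phi> ` J_comp d \<subseteq> J_comp d)"

definition J_ideal :: "'k::field free_jordan set \<Rightarrow> bool"
  where "J_ideal I \<longleftrightarrow> FJ.subspace I \<and> (\<forall>f\<in>I. \<forall>g. f * g \<in> I \<and> g * f \<in> I)"

definition T2_ideal :: "'k::field free_jordan set \<Rightarrow> bool"
  where "T2_ideal I \<longleftrightarrow> J_ideal I \<and> (\<forall>\<phi>. graded_endo \<phi> \<longrightarrow> \<phi> ` I \<subseteq> I)"

definition T2_ideal_gen :: "'k::field free_jordan set \<Rightarrow> 'k free_jordan set"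
  where "T2_ideal_gen G = \<Inter>{I. T2_ideal I \<and> G \<subseteq> I}"

lemma T2_ideal_T2_ideal_gen: "T2_ideal (T2_ideal_gen G)"
proof -
  have "FJ.subspace (T2_ideal_gen G)"
    unfolding T2_ideal_gen_def
    by (rule FJ.subspace_Inter) (auto simp: T2_ideal_def J_ideal_def)
  moreover have "f * g \<in> T2_ideal_gen G \<and> g * f \<in> T2_ideal_gen G" if "f \<in> T2_ideal_gen G" for f g
    using that unfolding T2_ideal_gen_def T2_ideal_def J_ideal_def by blast
  moreover have "\<phi> f \<in> T2_ideal_gen G" if "f \<in> T2_ideal_gen G" "graded_endo \<phi>" for f \<phi>
    using that unfolding T2_ideal_gen_def T2_ideal_def by blast
  ultimately show ?thesis
    unfolding T2_ideal_def J_ideal_def by blast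
qed

lemma T2_ideal_gen_least: "G \<subseteq> T2_ideal_gen G" "T2_ideal I \<Longrightarrow> G \<subseteq> I \<Longrightarrow> T2_ideal_gen G \<subseteq> I"
  unfolding T2_ideal_gen_def by auto


section \<open>The Jordan algebra of upper triangular matrices and its classical grading\<close>

definition mscale :: "'k::field \<Rightarrow> 'k^2^2 \<Rightarrow> 'k^2^2"
  where "mscale c A = (\<chi> i j. c * A $ i $ j)"

definition e_unit :: "2 \<Rightarrow> 2 \<Rightarrow> 'k::field^2^2"
  where "e_unit i j = (\<chi> k l. if k = i \<and> l = j then 1 else 0)"

definition UT2 :: "('k::field^2^2) set"
  where "UT2 = {A. A $ 2 $ 1 = 0}"

definition jprod :: "'k::field^2^2 \<Rightarrow> 'k^2^2 \<Rightarrow> 'k^2^2"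
  where "jprod u v = mscale (1 / 2) (u ** v + v ** u)"

definition UJ2_comp :: "bit \<Rightarrow> ('k::field^2^2) set"
  where "UJ2_comp d = (if d = 0
    then module.span mscale {e_unit 1 1 + e_unit 2 2, e_unit 1 1 - e_unit 2 2}
    else module.span mscale {e_unit 1 2})"

text \<open>A substitution of elements of \<open>UJ\<^sub>2\<close> for the variables is identified with the homomorphism
  \<open>J(X) \<rightarrow> UJ\<^sub>2\<close> extending it; see \<open>graded_subst_exists\<close> below for the existence of these.\<close>

definition graded_subst :: "('k::field free_jordan \<Rightarrow> 'k^2^2) \<Rightarrow> bool"
  where "graded_subst \<phi> \<longleftrightarrow>
    unital_alg_hom scaleJ (*) 1 mscale jprod (mat 1) \<phi> \<and> range \<phi> \<subseteq> UT2 \<and>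
    (\<forall>i. \<phi> (yv i) \<in> UJ2_comp 0) \<and> (\<forall>i. \<phi> (zv i) \<in> UJ2_comp 1)"

definition T_Cla :: "'k::field free_jordan set"
  where "T_Cla = {f. \<forall>\<phi>. graded_subst \<phi> \<longrightarrow> \<phi> f = 0}"

global_interpretation M2: vector_space "mscale :: 'k::field \<Rightarrow> _"
  by unfold_locales (auto simp: mscale_def vec_eq_iff algebra_simps)

lemma jprod_jordan:
  assumes "(2::'k::field) \<noteq> 0"
  shows "unital_jordan_algebra (mscale :: 'k \<Rightarrow> _) jprod (mat 1)"
proof -
  have h: "1 / 2 * (x + x) = x" for x :: 'k
    using assms by (metis mult.assoc mult_2 mult_1 divide_self_if times_divide_eq_left)
  have sl: "mscale c A ** B = mscale c (A ** B)" and sr: "A ** mscale c B = mscale c (A ** B)"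
    for c and A B :: "'k^2^2"
    by (auto simp: mscale_def matrix_matrix_mult_def vec_eq_iff sum_distrib_left algebra_simps)
  have ar: "(A + B) ** C = A ** C + B ** C" for A B C :: "'k^2^2"
    by (auto simp: matrix_matrix_mult_def vec_eq_iff sum.distrib algebra_simps)
  show ?thesis
  proof
    fix u v w :: "'k^2^2" and c :: 'k
    show "jprod u v = jprod v u" by (simp add: jprod_def add.commute)
    show "jprod (u + v) w = jprod u w + jprod v w"
      by (simp add: jprod_def ar matrix_add_ldistrib M2.scale_right_distrib add_ac)
    show "jprod (mscale c u) v = mscale c (jprod u v)"
      by (simp add: jprod_def sl sr M2.scale_right_distrib mult.commute)
    show "jprod (mat 1) u = u"
      unfolding jprod_def matrix_mul_lid matrix_mul_rid
      by (simp only: mscale_def vec_eq_iff vec_lambda_beta vector_add_component h) simp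
    have sq: "jprod u u = u ** u"
      by (simp only: jprod_def mscale_def vec_eq_iff vec_lambda_beta vector_add_component h) simp
    show "jprod (jprod (jprod u u) v) u = jprod (jprod u u) (jprod v u)"
      unfolding sq
      by (simp add: jprod_def sl sr ar matrix_add_ldistrib M2.scale_right_distrib
          matrix_mul_assoc add_ac)
  qed
qed

lemma UJ2_comp_subset: "(UJ2_comp d :: ('k::field^2^2) set) \<subseteq> UT2"
proof -
  have "M2.subspace (UT2 :: ('k^2^2) set)"
    by (auto simp: M2.subspace_def UT2_def mscale_def)
  moreover have "{e_unit 1 1 + e_unit 2 2, e_unit 1 1 - e_unit 2 2} \<subseteq> (UT2 :: ('k^2^2) set)"
    "{e_unit 1 2} \<subseteq> (UT2 :: ('k^2^2) set)"
    by (auto simp: UT2_def e_unit_def)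
  ultimately show ?thesis
    unfolding UJ2_comp_def by (simp add: M2.span_minimal)
qed

lemma graded_subst_exists:
  fixes a b :: "nat \<Rightarrow> 'k::field^2^2"
  assumes "(2::'k) \<noteq> 0" and a: "\<And>i. a i \<in> UJ2_comp 0" and b: "\<And>i. b i \<in> UJ2_comp 1"
  shows "\<exists>!\<phi>. graded_subst \<phi> \<and> (\<forall>i. \<phi> (yv i) = a i) \<and> (\<forall>i. \<phi> (zv i) = b i)"
proof -
  interpret uj: unital_jordan_algebra mscale jprod "mat 1 :: 'k^2^2"
    by (rule jprod_jordan) fact
  have "range \<phi> \<subseteq> UT2"
    if hom: "unital_alg_hom scaleJ (*) 1 mscale jprod (mat 1) \<phi>"
      and gens: "\<forall>i. \<phi> (yv i) = a i" "\<forall>i. \<phi> (zv i) = b i"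
    for \<phi> :: "'k free_jordan \<Rightarrow> 'k^2^2"
  proof -
    interpret lin: Vector_Spaces.linear scaleJ mscale \<phi>
      using hom by (simp add: unital_alg_hom_def)
    have "\<phi> (abs_free_jordan t) \<in> UT2" for t
    proof (induction t)
      case (TY i)
      then show ?case using gens(1) a[of i] UJ2_comp_subset by (auto simp flip: yv.abs_eq)
    next
      case (TZ i)
      then show ?case using gens(2) b[of i] UJ2_comp_subset by (auto simp flip: zv.abs_eq)
    next
      case TOne
      then show ?case using hom
        by (simp add: unital_alg_hom_def UT2_def mat_def flip: one_free_jordan_def)
    next
      case TZero
      then show ?case using lin.zero by (simp add: UT2_def flip: zero_free_jordan_def)
    next
      case (TAdd s t)
      then show ?case using lin.add[of "abs_free_jordan s" "abs_free_jordan t"]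
        by (simp add: plus_free_jordan.abs_eq UT2_def)
    next
      case (TScale c s)
      then show ?case using lin.scale[of c "abs_free_jordan s"]
        by (simp add: scaleJ.abs_eq UT2_def mscale_def)
    next
      case (TMult s t)
      have "\<phi> (abs_free_jordan (TMult s t)) =
          jprod (\<phi> (abs_free_jordan s)) (\<phi> (abs_free_jordan t))"
        using hom unfolding unital_alg_hom_def by (metis times_free_jordan.abs_eq)
      with TMult show ?case
        by (simp add: UT2_def jprod_def mscale_def matrix_matrix_mult_def sum_2)
    qed
    then show ?thesis
    proof (intro image_subsetI)
      fix f :: "'k free_jordan"
      show "\<phi> f \<in> UT2"
        by (induction f) (rule \<open>\<And>t. \<phi> (abs_free_jordan t) \<in> UT2\<close>)
    qed
  qed
  then show ?thesis
    using uj.free_jordan_universal[of a b] a b unfolding graded_subst_def by metis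
qed


section \<open>The ideal and the quotient\<close>

definition I_gens :: "'k::{field,finite} free_jordan set"
  where "I_gens = {assoc (yv 0) (yv 1) (yv 2), zv 0 * zv 1, assoc (yv 0) (zv 0) (yv 1),
    lpow (yv 0) CARD('k) - yv 0}"

definition I' :: "'k::{field,finite} free_jordan set"
  where "I' = T2_ideal_gen I_gens"

lemma subspace_I': "FJ.subspace I'"
  using T2_ideal_T2_ideal_gen[of I_gens] unfolding I'_def T2_ideal_def J_ideal_def by blast

definition cong_I' :: "'k::{field,finite} free_jordan \<Rightarrow> 'k free_jordan \<Rightarrow> bool"
  where "cong_I' f g \<longleftrightarrow> f - g \<in> I'"

quotient_type (overloaded) 'k J_mod_I' = "'k::{field,finite} free_jordan" / cong_I'
  morphisms rep_mod cosetI
proof (intro equivpI reflpI sympI transpI)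
  fix f g h :: "'k free_jordan"
  show "cong_I' f f"
    using FJ.subspace_0[OF subspace_I'] by (simp add: cong_I'_def)
  show "cong_I' g f" if "cong_I' f g"
    using that FJ.subspace_neg[OF subspace_I', of "f - g"] by (simp add: cong_I'_def)
  show "cong_I' f h" if "cong_I' f g" "cong_I' g h"
    using that FJ.subspace_add[OF subspace_I', of "f - g" "g - h"] by (simp add: cong_I'_def)
qed

instantiation J_mod_I' :: ("{field,finite}") ab_group_add
begin
lift_definition zero_J_mod_I' :: "'a J_mod_I'" is 0 .
lift_definition plus_J_mod_I' :: "'a J_mod_I' \<Rightarrow> 'a J_mod_I' \<Rightarrow> 'a J_mod_I'" is "(+)"
  unfolding cong_I'_def using FJ.subspace_add[OF subspace_I'] by (metis add_diff_add)
lift_definition uminus_J_mod_I' :: "'a J_mod_I' \<Rightarrow> 'a J_mod_I'" is uminus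
  unfolding cong_I'_def using FJ.subspace_neg[OF subspace_I'] by (metis minus_diff_minus)
lift_definition minus_J_mod_I' :: "'a J_mod_I' \<Rightarrow> 'a J_mod_I' \<Rightarrow> 'a J_mod_I'" is "(-)"
  unfolding cong_I'_def using FJ.subspace_diff[OF subspace_I']
  by (metis (no_types, lifting) diff_diff_eq diff_diff_eq2 add_diff_eq diff_add_eq add.commute)
instance
  by standard (transfer, simp add: cong_I'_def FJ.subspace_0[OF subspace_I'] add_ac)+
end

lift_definition scaleQ :: "'k::{field,finite} \<Rightarrow> 'k J_mod_I' \<Rightarrow> 'k J_mod_I'" is scaleJ
  unfolding cong_I'_def using FJ.subspace_scale[OF subspace_I']
  by (metis FJ.scale_right_diff_distrib)

global_interpretation Q: vector_space "scaleQ :: 'k::{field,finite} \<Rightarrow> _"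
  by unfold_locales
     (transfer, simp add: cong_I'_def FJ.subspace_0[OF subspace_I']
        FJ.scale_right_distrib FJ.scale_left_distrib)+


section \<open>The set \<open>S\<close>-hat\<close>

text \<open>\<open>Ymon r k\<close> is \<open>y\<^sub>1^k\<^sub>1 \<dots> y\<^sub>r^k\<^sub>r\<close>, with \<open>k\<close> zero-based; \<open>Yvars r k\<close> is the nondecreasing
  list of the (zero-based) indices of its variables with multiplicity.\<close>

definition Ymon :: "nat \<Rightarrow> (nat \<Rightarrow> nat) \<Rightarrow> 'k::field free_jordan"
  where "Ymon r k = lprod (map (\<lambda>i. lpow (yv i) (k i)) [0..<r])"

definition Yvars :: "nat \<Rightarrow> (nat \<Rightarrow> nat) \<Rightarrow> nat list"
  where "Yvars r k = concat (map (\<lambda>i. replicate (k i) i) [0..<r])"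

text \<open>\<^const>\<open>lenlex\<close> compares lengths first and then lists of equal length at the first
  position where they differ.\<close>

definition Y_le :: "nat list \<Rightarrow> nat list \<Rightarrow> bool"
  where "Y_le is js \<longleftrightarrow> is = js \<or> (is, js) \<in> lenlex {(i, j). i < j}"

definition S_hat :: "'k::{field,finite} free_jordan set"
  where "S_hat =
    {Ymon r k | r k. 1 \<le> r \<and> (\<forall>i<r. k i < CARD('k))} \<union>
    {Ymon r k * (zv i * Ymon r l) | r k l i. 1 \<le> r \<and>
       (\<forall>j<r. k j < CARD('k)) \<and> (\<forall>j<r. l j < CARD('k)) \<and> Y_le (Yvars r k) (Yvars r l)}"

end

theory Submission
  imports Defs "HOL-Computational_Algebra.Polynomial"
begin

text \<open>
  Modulo \<open>I'\<close> the even part is a commutative associative algebra in which \<open>y^q = y\<close>, products of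
  odd elements vanish, and the multiplications \<open>L\<^sub>a\<close> by even elements \<open>a\<close> commute on the odd part.
  There the linearized Jordan identity reads
  \<open>2 L\<^sub>a L\<^sub>b L\<^sub>c = L\<^sub>a\<^sub>b L\<^sub>c + L\<^sub>b\<^sub>c L\<^sub>a + L\<^sub>c\<^sub>a L\<^sub>b - L\<^sub>a\<^sub>b\<^sub>c\<close>, so two factors around each \<open>z\<^sub>i\<close> suffice.

  Conversely, substituting \<open>diag(a\<^sub>j, b\<^sub>j)\<close> for \<open>y\<^sub>j\<close> and \<open>e\<^sub>1\<^sub>2\<close> for \<open>z\<^sub>i\<close> turns the polynomial with
  exponents \<open>k, l\<close> into the function \<open>(a^k + b^k) (a^l + b^l) / 4\<close>. Over a field with \<open>q\<close> elements
  the monomial functions with exponents below \<open>q\<close> are independent. If \<open>k\<close> and \<open>l\<close> are nonzero,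
  only \<open>{k, l}\<close> contributes to \<open>a^k b^l\<close>; once these polynomials are removed, \<open>a^l\<close> isolates \<open>{0, l}\<close>.
  So no nontrivial combination of the polynomials is an identity, which gives both
  independence and the equality of ideals.
\<close>

section \<open>Homomorphisms and the grading\<close>

context unital_jordan_algebra
begin

lemma mult_add_right: "mult u (v + w) = mult u v + mult u w"
  by (metis mult_commute mult_add_left)

lemma mult_scale_right: "mult u (scale c v) = scale c (mult u v)"
  by (metis mult_commute mult_scale_left)

lemma mult_unit_right: "mult u unit = u"
  by (metis mult_commute mult_unit_left)

lemma mult_zero_left: "mult 0 u = 0"
  by (metis mult_scale_left scale_zero_left)

lemma mult_zero_right: "mult u 0 = 0"
  by (metis mult_commute mult_zero_left)

lemma mult_minus_left: "mult (- u) v = - mult u v"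
  by (metis add.right_inverse add_eq_0_iff mult_add_left mult_zero_left)

lemma mult_diff_left: "mult (u - v) w = mult u w - mult v w"
  by (metis diff_conv_add_uminus mult_add_left mult_minus_left)

lemma mult_diff_right: "mult u (v - w) = mult u v - mult u w"
  by (metis mult_commute mult_diff_left)

lemma mult_span:
  assumes AB: "\<And>a b. a \<in> A \<Longrightarrow> b \<in> B \<Longrightarrow> mult a b \<in> W" and W: "subspace W"
    and u: "u \<in> span A" and v: "v \<in> span B"
  shows "mult u v \<in> W"
  using u
proof (induction rule: span_induct_alt)
  case base
  then show ?case by (simp add: mult_zero_left subspace_0[OF W])
next
  case (step c a u)
  have "mult a v \<in> W"
    using v
    by (induction rule: span_induct_alt)
      (auto simp: mult_zero_right mult_add_right mult_scale_right AB step
        intro!: subspace_0[OF W] subspace_add[OF W] subspace_scale[OF W])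
  then show ?case
    by (simp add: mult_add_left mult_scale_left step subspace_add[OF W] subspace_scale[OF W])
qed

text \<open>Full polarization: for fixed \<open>y\<close>, \<open>T\<close> is trilinear and
  symmetric in its first two arguments, and the Jordan identity reads \<open>T f f f = 0\<close>.
  Two rounds of expansion lead to \<open>N + N = 0\<close>, so only 2 has to be inverted and
  characteristic 3 is covered.\<close>

lemma linearized_jordan_identity:
  assumes "(2::'k) \<noteq> 0"
  shows "mult (mult (mult x w) y) u + mult (mult (mult w u) y) x + mult (mult (mult x u) y) w =
    mult (mult x w) (mult y u) + mult (mult w u) (mult y x) + mult (mult x u) (mult y w)"
proof -
  define T where "T a b c = mult (mult (mult a b) y) c - mult (mult a b) (mult y c)" for a b c
  have T: "T f f f = 0" "T f g h = T g f h"
    "T (f + f') g h = T f g h + T f' g h" "T f (g + g') h = T f g h + T f g' h"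
    "T f g (h + h') = T f g h + T f g h'" for f f' g g' h h'
    by (simp_all add: T_def jordan_identity mult_add_left mult_add_right mult_commute[of f g])
  define N where "N = T x w u + T w u x + T x u w"
  \<comment> \<open>\<open>A f g\<close> collects the terms of
    \<open>T (f + g) (f + g) (f + g)\<close> that are quadratic in \<open>f\<close> and linear in
    \<open>g\<close>.\<close>
  define A where "A f g = T f f g + (T f g f + T f g f)" for f g
  have A: "A f g + A g f = 0" for f g
  proof -
    have "T (f + g) (f + g) (f + g) = T f f f + T g g g + (A f g + A g f)"
      unfolding A_def T(3-5) T(2)[of g f] by (simp only: add_ac)
    then show ?thesis by (simp only: T(1)) simp
  qed
  \<comment> \<open>Second round: the part linear in each of \<open>x\<close>, \<open>w\<close>,
    \<open>u\<close> is \<open>N\<close> twice.\<close>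
  have "A (x + u) w + A w (x + u) = (A x w + A w x) + (A u w + A w u) + (N + N)"
    unfolding A_def N_def T(3-5) T(2)[of w x] T(2)[of u x] T(2)[of u w] by (simp only: add_ac)
  then have "N + N = 0"
    by (simp add: A)
  then have "scale 2 N = 0"
    using scale_left_distrib[of 1 1 N] by simp
  then have "N = 0"
    using assms by simp
  then show ?thesis
    by (simp add: N_def T_def algebra_simps)
qed

text \<open>The target and its family \<open>C\<close> are left general, so that the lemma serves
  both endomorphisms of J(X) and substitutions of matrices.\<close>

lemma hom_J_comp:
  assumes hom: "unital_alg_hom scaleJ (*) 1 scale mult unit \<phi>"
    and C: "\<And>d. subspace (C d)" "unit \<in> C 0"
      "\<And>d e u v. u \<in> C d \<Longrightarrow> v \<in> C e \<Longrightarrow> mult u v \<in> C (d + e)"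
    and gens: "\<And>i. \<phi> (yv i) \<in> C 0" "\<And>i. \<phi> (zv i) \<in> C 1"
    and f: "f \<in> J_comp d"
  shows "\<phi> f \<in> C d"
proof -
  interpret lin: Vector_Spaces.linear scaleJ scale \<phi>
    using hom by (simp add: unital_alg_hom_def)
  have mon: "\<phi> u \<in> C d" if "monomial_deg d u" for u d
    using that
    by induction (use hom C gens in \<open>auto simp: unital_alg_hom_def\<close>)
  show ?thesis
    using f unfolding J_comp_def
    by (induction rule: FJ.span_induct_alt)
      (auto simp: lin.zero lin.add lin.scale mon
        intro!: subspace_0[OF C(1)] subspace_add[OF C(1)] subspace_scale[OF C(1)])
qed

end

lemma subspace_J_comp: "FJ.subspace (J_comp d)"
  by (simp add: J_comp_def FJ.subspace_span)

lemma J_comp_monomial: "monomial_deg d u \<Longrightarrow> u \<in> J_comp d"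
  by (simp add: J_comp_def FJ.span_base)

lemma J_comp_mult:
  assumes "u \<in> J_comp d" "v \<in> J_comp e"
  shows "u * v \<in> J_comp (d + e)"
  by (rule FJ.mult_span[OF _ subspace_J_comp assms[unfolded J_comp_def]])
    (simp_all only: mem_Collect_eq J_comp_monomial[OF monomial_deg.mult])

lemma graded_endo_exists:
  assumes "\<And>i. a i \<in> J_comp 0" "\<And>i. b i \<in> J_comp 1"
  shows "\<exists>\<phi>. graded_endo \<phi> \<and> (\<forall>i. \<phi> (yv i) = a i) \<and> (\<forall>i. \<phi> (zv i) = b i)"
proof -
  obtain \<phi> where hom: "unital_alg_hom scaleJ (*) 1 scaleJ (*) 1 \<phi>"
    and gens: "\<forall>i. \<phi> (yv i) = a i" "\<forall>i. \<phi> (zv i) = b i"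
    using FJ.free_jordan_universal[of a b] by blast
  have "\<phi> f \<in> J_comp d" if "f \<in> J_comp d" for f d
    by (rule FJ.hom_J_comp[where C = J_comp, OF hom subspace_J_comp _ J_comp_mult _ _ that])
      (auto simp: gens assms intro: J_comp_monomial monomial_deg.intros)
  then show ?thesis
    using hom gens unfolding graded_endo_def by blast
qed

lemma hom_lpow:
  assumes "unital_alg_hom scaleJ (*) 1 sc mu e \<phi>"
  shows "\<phi> (lpow u n) = foldl mu e (replicate n (\<phi> u))"
proof -
  \<comment> \<open>The starting value is generalised because the fold changes it at every
    step.\<close>
  have "\<phi> (foldl (*) v (replicate n u)) = foldl mu (\<phi> v) (replicate n (\<phi> u))" for v
    by (induction n arbitrary: v) (use assms in \<open>auto simp: unital_alg_hom_def\<close>)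
  then show ?thesis
    using assms by (simp add: lpow_def lprod_def unital_alg_hom_def)
qed

section \<open>Left-normed powers and monomials in the even variables\<close>

lemma lpow_0 [simp]: "lpow u 0 = 1"
  by (simp add: lpow_def lprod_def)

lemma lpow_Suc: "lpow u (Suc n) = lpow u n * u"
  by (simp add: lpow_def lprod_def flip: replicate_append_same)

lemma Ymon_0 [simp]: "Ymon 0 k = 1"
  by (simp add: Ymon_def lprod_def)

lemma Ymon_Suc: "Ymon (Suc r) k = Ymon r k * lpow (yv r) (k r)"
  by (simp add: Ymon_def lprod_def)

lemma Ymon_cong: "(\<And>j. j < r \<Longrightarrow> k j = l j) \<Longrightarrow> Ymon r k = Ymon r l"
  by (induction r) (auto simp: Ymon_Suc)

lemma Yvars_Suc: "Yvars (Suc r) k = Yvars r k @ replicate (k r) r"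
  by (simp add: Yvars_def)

lemma Yvars_cong: "(\<And>j. j < r \<Longrightarrow> k j = l j) \<Longrightarrow> Yvars r k = Yvars r l"
  by (induction r) (auto simp: Yvars_Suc Yvars_def[of 0])

lemma J_comp_lpow: "u \<in> J_comp 0 \<Longrightarrow> lpow u n \<in> J_comp 0"
  by (induction n) (use J_comp_mult[of _ 0 _ 0] in
      \<open>auto simp: lpow_Suc intro: J_comp_monomial monomial_deg.one\<close>)

lemma J_comp_Ymon: "Ymon r k \<in> J_comp 0"
proof (induction r)
  case (Suc r)
  have "lpow (yv r) (k r) \<in> J_comp 0"
    by (intro J_comp_lpow J_comp_monomial monomial_deg.even)
  with Suc show ?case
    using J_comp_mult[of _ 0 _ 0] by (simp add: Ymon_Suc)
qed (simp add: J_comp_monomial monomial_deg.one)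


section \<open>Evaluation in upper triangular matrices\<close>

text \<open>With the diagonal first and the corner last, the homogeneous components become
  \<open>c = 0\<close> and \<open>a = b = 0\<close>, and all computations reduce to scalars.\<close>

definition ut :: "'k::field \<Rightarrow> 'k \<Rightarrow> 'k \<Rightarrow> 'k^2^2"
  where "ut a b c = (\<chi> i j. if i = 1 then (if j = 1 then a else c) else (if j = 1 then 0 else b))"

lemma ut_nth [simp]: "ut a b c $ 1 $ 1 = a" "ut a b c $ 1 $ 2 = c"
  "ut a b c $ 2 $ 1 = 0" "ut a b c $ 2 $ 2 = b"
  by (simp_all add: ut_def)

lemma ut_eq_iff: "A = ut a b c \<longleftrightarrow> A $ 1 $ 1 = a \<and> A $ 1 $ 2 = c \<and> A $ 2 $ 1 = 0 \<and> A $ 2 $ 2 = b"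
  by (auto simp: vec_eq_iff forall_2)

lemma ut_one: "mat 1 = ut 1 1 0"
  by (simp add: ut_eq_iff mat_def)

lemma ut_zero: "0 = ut 0 0 0"
  by (simp add: ut_eq_iff)

lemma ut_add: "ut a b c + ut a' b' c' = ut (a + a') (b + b') (c + c')"
  by (simp add: ut_eq_iff)

lemma ut_scale: "mscale d (ut a b c) = ut (d * a) (d * b) (d * c)"
  by (simp add: ut_eq_iff mscale_def)

text \<open>On the corner, a diagonal matrix acts as multiplication by the mean of its two entries;
  this mean is what makes the values symmetric under exchanging the diagonal entries.\<close>

lemma jprod_ut:
  assumes "(2::'k::field) \<noteq> 0"
  shows "jprod (ut a b c) (ut a' b' (c'::'k)) =
    ut (a * a') (b * b') (((a + b) * c' + (a' + b') * c) / 2)"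
  using assms by (simp add: ut_eq_iff jprod_def mscale_def matrix_matrix_mult_def sum_2 field_simps)

lemma UJ2_comp_eq:
  assumes "(2::'k::field) \<noteq> 0"
  shows "UJ2_comp d = (if d = 0 then {ut a b 0 | a b. True} else {ut 0 0 (c::'k) | c. True})"
proof -
  have "ut a b 0 = mscale ((a + b) / 2) (e_unit 1 1 + e_unit 2 2) +
      mscale ((a - b) / 2) (e_unit 1 1 - e_unit 2 2)" for a b :: 'k
    using assms
    by (simp add: vec_eq_iff forall_2 mscale_def e_unit_def flip: add_divide_distrib diff_divide_distrib)
  then have "ut a b 0 \<in> M2.span {e_unit 1 1 + e_unit 2 2, e_unit 1 1 - e_unit 2 2}" for a b :: 'k
    by (simp add: M2.span_add M2.span_scale M2.span_base)
  moreover have "M2.span {e_unit 1 1 + e_unit 2 2, e_unit 1 1 - e_unit 2 2 :: 'k^2^2}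
      \<subseteq> {ut a b 0 | a b. True}"
    by (rule M2.span_minimal)
      (auto simp: M2.subspace_def ut_zero ut_add ut_scale, auto simp: ut_eq_iff e_unit_def)
  moreover have "ut 0 0 c \<in> M2.span {e_unit 1 2}" for c :: 'k
  proof -
    have "ut 0 0 c = mscale c (e_unit 1 2)"
      by (simp add: vec_eq_iff forall_2 mscale_def e_unit_def)
    then show ?thesis by (simp add: M2.span_scale M2.span_base)
  qed
  moreover have "M2.span {e_unit 1 2 :: 'k^2^2} \<subseteq> {ut 0 0 c | c. True}"
    by (rule M2.span_minimal)
      (auto simp: M2.subspace_def ut_zero ut_add ut_scale, auto simp: ut_eq_iff e_unit_def)
  ultimately show ?thesis
    unfolding UJ2_comp_def by auto
qed


section \<open>The quotient algebra\<close>

lemma I'_mult: "f \<in> I' \<Longrightarrow> f * g \<in> I'" "f \<in> I' \<Longrightarrow> g * f \<in> I'"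
  using T2_ideal_T2_ideal_gen[of I_gens] unfolding I'_def T2_ideal_def J_ideal_def by blast+

instantiation J_mod_I' :: ("{field,finite}") "{one,times}"
begin
lift_definition one_J_mod_I' :: "'a J_mod_I'" is 1 .
lift_definition times_J_mod_I' :: "'a J_mod_I' \<Rightarrow> 'a J_mod_I' \<Rightarrow> 'a J_mod_I'" is "(*)"
proof -
  fix f f' g g' :: "'a free_jordan"
  assume "cong_I' f f'" "cong_I' g g'"
  \<comment> \<open>Telescoping of \<open>f * g - f' * g'\<close>.\<close>
  then have "(f - f') * g + f' * (g - g') \<in> I'"
    unfolding cong_I'_def by (intro FJ.subspace_add[OF subspace_I'] I'_mult)
  then show "cong_I' (f * g) (f' * g')"
    by (simp add: cong_I'_def FJ.mult_diff_left FJ.mult_diff_right)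
qed
instance ..
end

lemma cosetI_eq_iff: "cosetI f = cosetI g \<longleftrightarrow> f - g \<in> I'"
  by (simp add: J_mod_I'.abs_eq_iff cong_I'_def)

lemmas cosetI_simps =
  zero_J_mod_I'.abs_eq one_J_mod_I'.abs_eq plus_J_mod_I'.abs_eq minus_J_mod_I'.abs_eq
  times_J_mod_I'.abs_eq scaleQ.abs_eq

lemma cosetI_surj: obtains f where "u = cosetI f"
  by (metis Quotient_J_mod_I' Quotient_abs_rep)

text \<open>Makes the linearized Jordan identity available for cosets.\<close>

global_interpretation QJ:
  unital_jordan_algebra scaleQ "(*)" "1 :: 'k::{field,finite} J_mod_I'"
proof
  fix u v w :: "'k J_mod_I'" and c :: 'k
  obtain f g h where [simp]: "u = cosetI f" "v = cosetI g" "w = cosetI h"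
    by (metis cosetI_surj)
  show "u * v = v * u" "(u + v) * w = u * w + v * w" "scaleQ c u * v = scaleQ c (u * v)"
    "1 * u = u" "((u * u) * v) * u = (u * u) * (v * u)"
    by (simp_all add: cosetI_simps FJ.mult_add_left FJ.mult_scale_left FJ.mult_unit_left
        FJ.jordan_identity FJ.mult_commute[of f g])
qed

section \<open>Homogeneous components of the quotient and the relations between them\<close>

definition Q_comp :: "bit \<Rightarrow> 'k::{field,finite} J_mod_I' set"
  where "Q_comp d = cosetI ` J_comp d"

lemma Q_comp_mult: "u \<in> Q_comp d \<Longrightarrow> v \<in> Q_comp e \<Longrightarrow> u * v \<in> Q_comp (d + e)"
  unfolding Q_comp_def
  by (elim imageE, hypsubst, subst times_J_mod_I'.abs_eq, intro imageI J_comp_mult)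

lemmas Q_comp_even_mult = Q_comp_mult[of _ 0 _ 0, simplified]
  and Q_comp_even_odd_mult = Q_comp_mult[of _ 0 _ 1, simplified]

text \<open>Graded endomorphisms with prescribed homogeneous images exist and preserve
  \<open>I'\<close>. Each relation below comes from choosing \<open>a\<close> and \<open>b\<close>
  for one generator.\<close>

lemma I_gens_subst:
  assumes "g \<in> I_gens" "\<And>i. a i \<in> J_comp 0" "\<And>i. b i \<in> J_comp 1"
  shows "\<exists>\<phi>. unital_alg_hom scaleJ (*) 1 scaleJ (*) 1 \<phi> \<and>
    (\<forall>i. \<phi> (yv i) = a i) \<and> (\<forall>i. \<phi> (zv i) = b i) \<and> \<phi> g \<in> I'"
proof -
  obtain \<phi> where \<phi>: "graded_endo \<phi>" "\<forall>i. \<phi> (yv i) = a i" "\<forall>i. \<phi> (zv i) = b i"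
    using graded_endo_exists assms(2,3) by metis
  have "\<phi> g \<in> I'"
    using \<phi>(1) assms(1) T2_ideal_T2_ideal_gen[of I_gens] T2_ideal_gen_least(1)[of I_gens]
    unfolding I'_def T2_ideal_def by blast
  then show ?thesis
    using \<phi> unfolding graded_endo_def by blast
qed

lemma hom_diff:
  assumes "unital_alg_hom sc mu e sc' mu' e' \<phi>"
  shows "\<phi> (u - v) = \<phi> u - \<phi> v"
proof -
  interpret Vector_Spaces.linear sc sc' \<phi>
    using assms by (simp add: unital_alg_hom_def)
  show ?thesis by (rule diff)
qed

lemma hom_assoc:
  "unital_alg_hom scaleJ (*) 1 scaleJ (*) 1 \<phi> \<Longrightarrow> \<phi> (assoc u v w) = assoc (\<phi> u) (\<phi> v) (\<phi> w)"
  by (simp add: assoc_def hom_diff[of scaleJ "(*)" 1 scaleJ "(*)" 1]) (simp add: unital_alg_hom_def)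

text \<open>Provides the image of variables that are absent from a generator.\<close>

lemma zero_in_J_comp: "0 \<in> J_comp d"
  by (rule FJ.subspace_0[OF subspace_J_comp])

lemma Q_even_assoc:
  assumes "u \<in> Q_comp 0" "v \<in> Q_comp 0" "w \<in> Q_comp 0"
  shows "(u * v) * w = u * (v * w)"
proof -
  obtain f g h where fgh: "u = cosetI f" "v = cosetI g" "w = cosetI h"
    "f \<in> J_comp 0" "g \<in> J_comp 0" "h \<in> J_comp 0"
    using assms unfolding Q_comp_def by blast
  let ?a = "\<lambda>i::nat. if i = 0 then f else if i = 1 then g else h"
  have "\<exists>\<phi>. unital_alg_hom scaleJ (*) 1 scaleJ (*) 1 \<phi> \<and> (\<forall>i. \<phi> (yv i) = ?a i) \<and>
      (\<forall>i. \<phi> (zv i) = 0) \<and> \<phi> (assoc (yv 0) (yv 1) (yv 2)) \<in> I'"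
    by (rule I_gens_subst) (auto simp: I_gens_def fgh zero_in_J_comp)
  then obtain \<phi> where hom: "unital_alg_hom scaleJ (*) 1 scaleJ (*) 1 \<phi>" and
    \<phi>: "\<forall>i. \<phi> (yv i) = ?a i" "\<phi> (assoc (yv 0) (yv 1) (yv 2)) \<in> I'"
    by blast
  then have "assoc f g h \<in> I'"
    by (simp add: hom_assoc)
  then show ?thesis
    by (simp add: fgh times_J_mod_I'.abs_eq cosetI_eq_iff assoc_def)
qed

lemma Q_even_odd_even:
  assumes "u \<in> Q_comp 0" "x \<in> Q_comp 1" "w \<in> Q_comp 0"
  shows "(u * x) * w = u * (x * w)"
proof -
  obtain f g h where fgh: "u = cosetI f" "x = cosetI g" "w = cosetI h"
    "f \<in> J_comp 0" "g \<in> J_comp 1" "h \<in> J_comp 0"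
    using assms unfolding Q_comp_def by blast
  let ?a = "\<lambda>i::nat. if i = 0 then f else h"
  have "\<exists>\<phi>. unital_alg_hom scaleJ (*) 1 scaleJ (*) 1 \<phi> \<and> (\<forall>i. \<phi> (yv i) = ?a i) \<and>
      (\<forall>i. \<phi> (zv i) = g) \<and> \<phi> (assoc (yv 0) (zv 0) (yv 1)) \<in> I'"
    by (rule I_gens_subst) (auto simp: I_gens_def fgh)
  then obtain \<phi> where hom: "unital_alg_hom scaleJ (*) 1 scaleJ (*) 1 \<phi>" and
    \<phi>: "\<forall>i. \<phi> (yv i) = ?a i" "\<forall>i. \<phi> (zv i) = g" "\<phi> (assoc (yv 0) (zv 0) (yv 1)) \<in> I'"
    by blast
  then have "assoc f g h \<in> I'"
    by (simp add: hom_assoc)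
  then show ?thesis
    by (simp add: fgh times_J_mod_I'.abs_eq cosetI_eq_iff assoc_def)
qed

lemma Q_odd_odd:
  assumes "x \<in> Q_comp 1" "y \<in> Q_comp 1"
  shows "x * y = 0"
proof -
  obtain f g where fg: "x = cosetI f" "y = cosetI g" "f \<in> J_comp 1" "g \<in> J_comp 1"
    using assms unfolding Q_comp_def by blast
  let ?b = "\<lambda>i::nat. if i = 0 then f else g"
  have "\<exists>\<phi>. unital_alg_hom scaleJ (*) 1 scaleJ (*) 1 \<phi> \<and> (\<forall>i. \<phi> (yv i) = 0) \<and>
      (\<forall>i. \<phi> (zv i) = ?b i) \<and> \<phi> (zv 0 * zv 1) \<in> I'"
    by (rule I_gens_subst) (auto simp: I_gens_def fg zero_in_J_comp)
  then obtain \<phi> where "unital_alg_hom scaleJ (*) 1 scaleJ (*) 1 \<phi>" and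
    "\<forall>i. \<phi> (zv i) = ?b i" "\<phi> (zv 0 * zv 1) \<in> I'"
    by blast
  then have "f * g \<in> I'"
    by (simp add: unital_alg_hom_def)
  then show ?thesis
    by (simp add: fg times_J_mod_I'.abs_eq zero_J_mod_I'.abs_eq cosetI_eq_iff)
qed

lemma cosetI_lpow_card:
  assumes "f \<in> J_comp 0"
  shows "cosetI (lpow f CARD('k)) = cosetI (f :: 'k::{field,finite} free_jordan)"
proof -
  have "\<exists>\<phi>. unital_alg_hom scaleJ (*) 1 scaleJ (*) 1 \<phi> \<and> (\<forall>i. \<phi> (yv i) = f) \<and>
      (\<forall>i. \<phi> (zv i) = 0) \<and> \<phi> (lpow (yv 0) CARD('k) - yv 0) \<in> I'"
    by (rule I_gens_subst) (auto simp: I_gens_def assms zero_in_J_comp)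
  then obtain \<phi> where hom: "unital_alg_hom scaleJ (*) 1 scaleJ (*) 1 \<phi>" and
    \<phi>: "\<forall>i. \<phi> (yv i) = f" "\<phi> (lpow (yv 0) CARD('k) - yv 0) \<in> I'"
    by blast
  have "\<phi> (lpow (yv 0) CARD('k) - yv 0) = lpow f CARD('k) - f"
    using hom_lpow[OF hom] \<phi>(1) by (simp add: hom_diff[OF hom] lpow_def lprod_def)
  then show ?thesis
    using \<phi>(2) by (simp add: cosetI_eq_iff)
qed

text \<open>Commutativity of the product turns \<open>(a * x) * b = a * (x * b)\<close> into this
  commutation of two multiplication operators.\<close>

lemma Q_left_commute_odd:
  assumes "a \<in> Q_comp 0" "b \<in> Q_comp 0" "x \<in> Q_comp 1"
  shows "a * (b * x) = b * (a * x)"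
  using Q_even_odd_even[OF assms(1,3,2)] by (simp add: QJ.mult_commute)


section \<open>A spanning set\<close>

lemma card_field_ge_2: "2 \<le> CARD('k::{field,finite})"
  using card_mono[of UNIV "{0, 1 :: 'k}"] by simp

lemma cosetI_lpow_add:
  assumes "f \<in> J_comp 0"
  shows "cosetI (lpow f m) * cosetI (lpow f n) = cosetI (lpow f (m + n))"
proof (induction n)
  case 0
  then show ?case by (simp add: QJ.mult_unit_right flip: one_J_mod_I'.abs_eq)
next
  case (Suc n)
  have "cosetI (lpow f m) * cosetI (lpow f (Suc n)) =
      cosetI (lpow f m) * (cosetI (lpow f n) * cosetI f)"
    by (simp add: lpow_Suc times_J_mod_I'.abs_eq)
  also have "\<dots> = (cosetI (lpow f m) * cosetI (lpow f n)) * cosetI f"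
    by (rule Q_even_assoc[symmetric]) (auto simp: Q_comp_def assms J_comp_lpow)
  finally show ?case
    unfolding Suc by (simp add: lpow_Suc times_J_mod_I'.abs_eq)
qed

text \<open>Since the q-th power of \<open>f\<close> is congruent to \<open>f\<close>, an exponent
  \<open>n >= q\<close> drops to \<open>n - (q - 1)\<close>, which is smaller because
  \<open>q >= 2\<close>.\<close>

lemma cosetI_lpow_reduce:
  assumes "f \<in> J_comp 0"
  shows "\<exists>m<CARD('k). cosetI (lpow f n) = cosetI (lpow (f :: 'k::{field,finite} free_jordan) m)"
proof (induction n rule: less_induct)
  case (less n)
  show ?case
  proof (cases "n < CARD('k)")
    case False
    define d where "d = n - CARD('k)"
    have n: "n = CARD('k) + d" and "Suc d < n"
      using False card_field_ge_2[where 'k = 'k] by (auto simp: d_def)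
    have "cosetI (lpow f n) = cosetI f * cosetI (lpow f d)"
      unfolding n by (simp flip: cosetI_lpow_add add: assms cosetI_lpow_card)
    also have "\<dots> = cosetI (lpow f (Suc d))"
      by (simp add: QJ.mult_commute lpow_Suc flip: times_J_mod_I'.abs_eq)
    finally show ?thesis
      using less[OF \<open>Suc d < n\<close>] by simp
  qed auto
qed

text \<open>Extra variables with exponent 0 are harmless, so monomials in different numbers of
  variables can be brought to a common number.\<close>

lemma Ymon_pad: "r \<le> R \<Longrightarrow> Ymon R (\<lambda>j. if j < r then k j else 0) = Ymon r k"
proof (induction R rule: dec_induct)
  case base
  then show ?case by (simp cong: Ymon_cong)
qed (simp add: Ymon_Suc FJ.mult_unit_right)

lemma Yvars_pad: "r \<le> R \<Longrightarrow> Yvars R (\<lambda>j. if j < r then k j else 0) = Yvars r k"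
proof (induction R rule: dec_induct)
  case base
  then show ?case by (simp cong: Yvars_cong)
qed (simp add: Yvars_Suc)

lemma Q_even_mult_mult:
  assumes "a \<in> Q_comp 0" "b \<in> Q_comp 0" "c \<in> Q_comp 0" "d \<in> Q_comp 0"
  shows "(a * b) * (c * d) = (a * c) * (b * d)"
proof -
  have "(a * b) * (c * d) = a * ((b * c) * d)"
    using assms by (simp add: Q_even_assoc Q_comp_even_mult)
  also have "b * c = c * b"
    by (rule QJ.mult_commute)
  finally show ?thesis
    using assms by (simp add: Q_even_assoc Q_comp_even_mult)
qed

lemma cosetI_Ymon_add:
  "cosetI (Ymon r k) * cosetI (Ymon r l) =
    cosetI (Ymon r (\<lambda>j. k j + l j) :: 'k::{field,finite} free_jordan)"
proof (induction r)
  case 0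
  then show ?case by (simp add: QJ.mult_unit_right flip: one_J_mod_I'.abs_eq)
next
  case (Suc r)
  have y: "(yv r :: 'k free_jordan) \<in> J_comp 0"
    by (intro J_comp_monomial monomial_deg.even)
  then have "cosetI (Ymon (Suc r) k) * cosetI (Ymon (Suc r) l) =
      (cosetI (Ymon r k :: 'k free_jordan) * cosetI (Ymon r l)) *
      (cosetI (lpow (yv r) (k r)) * cosetI (lpow (yv r) (l r)))"
    unfolding Ymon_Suc times_J_mod_I'.abs_eq[symmetric]
    by (intro Q_even_mult_mult) (simp_all add: Q_comp_def J_comp_Ymon J_comp_lpow)
  then show ?case
    by (simp add: Suc cosetI_lpow_add[OF y] Ymon_Suc flip: times_J_mod_I'.abs_eq)
qed

lemma cosetI_Ymon_reduce:
  "\<exists>l. (\<forall>j. l j < CARD('k)) \<and> cosetI (Ymon r k) = cosetI (Ymon r l :: 'k::{field,finite} free_jordan)"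
proof -
  have "\<exists>l. \<forall>j. l j < CARD('k) \<and>
      cosetI (lpow (yv j) (k j)) = cosetI (lpow (yv j :: 'k free_jordan) (l j))"
    by (intro choice allI) (use cosetI_lpow_reduce[OF J_comp_monomial[OF monomial_deg.even]] in blast)
  then obtain l where l: "\<And>j. l j < CARD('k)"
    "\<And>j. cosetI (lpow (yv j) (k j)) = cosetI (lpow (yv j :: 'k free_jordan) (l j))"
    by blast
  have "cosetI (Ymon r k) = cosetI (Ymon r l :: 'k free_jordan)"
    by (induction r) (simp_all add: Ymon_Suc l(2) flip: times_J_mod_I'.abs_eq)
  with l(1) show ?thesis by blast
qed

text \<open>With unbounded exponents and \<open>r = 0\<close> allowed, products and \<open>1\<close>
  stay in the set; \<open>YQ_common\<close> restores the restrictions of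
  \<open>S_hat\<close>.\<close>

definition YQ :: "'k::{field,finite} J_mod_I' set"
  where "YQ = {cosetI (Ymon r k) | r k. True}"

text \<open>The two monomials are left unordered here; \<open>YQ_ZQ_subset\<close> puts them in
  order.\<close>

definition ZQ :: "'k::{field,finite} J_mod_I' set"
  where "ZQ = {a * (cosetI (zv i) * b) | a i b. a \<in> YQ \<and> b \<in> YQ}"

lemma YQ_common:
  assumes "a \<in> (YQ :: 'k::{field,finite} J_mod_I' set)" "b \<in> (YQ :: 'k J_mod_I' set)"
  obtains r k l where "1 \<le> r" "\<forall>j<r. k j < CARD('k)" "\<forall>j<r. l j < CARD('k)"
    "a = cosetI (Ymon r k)" "b = cosetI (Ymon r l)"
proof -
  obtain r k s l where "a = cosetI (Ymon r k)" "b = cosetI (Ymon s l)"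
    using assms unfolding YQ_def by blast
  \<comment> \<open>The 1 secures \<open>1 \<le> R\<close> even if both monomials are empty.\<close>
  moreover define R where "R = max 1 (max r s)"
  ultimately have ab: "a = cosetI (Ymon R (\<lambda>j. if j < r then k j else 0))"
    "b = cosetI (Ymon R (\<lambda>j. if j < s then l j else 0))"
    by (simp_all add: Ymon_pad)
  obtain k' where k': "\<forall>j. k' j < CARD('k)" "a = cosetI (Ymon R k')"
    using cosetI_Ymon_reduce[of R "\<lambda>j. if j < r then k j else 0", where 'k = 'k]
    unfolding ab(1)[symmetric] by (elim exE conjE)
  obtain l' where l': "\<forall>j. l' j < CARD('k)" "b = cosetI (Ymon R l')"
    using cosetI_Ymon_reduce[of R "\<lambda>j. if j < s then l j else 0", where 'k = 'k]
    unfolding ab(2)[symmetric] by (elim exE conjE)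
  show ?thesis
    by (rule that[of R k' l']) (use k' l' in \<open>simp_all add: R_def\<close>)
qed

lemma YQ_mult: "a \<in> YQ \<Longrightarrow> b \<in> YQ \<Longrightarrow> a * b \<in> YQ"
  by (erule (1) YQ_common) (auto simp: cosetI_Ymon_add YQ_def)

lemma YQ_one: "1 \<in> YQ"
  unfolding YQ_def one_J_mod_I'.abs_eq by (metis (mono_tags) Ymon_0 mem_Collect_eq)

lemma YQ_even: "YQ \<subseteq> Q_comp 0"
  by (auto simp: YQ_def Q_comp_def J_comp_Ymon)

lemma cosetI_zv_odd: "cosetI (zv i) \<in> Q_comp 1"
  by (auto simp: Q_comp_def J_comp_monomial monomial_deg.odd)

lemma ZQ_odd: "ZQ \<subseteq> Q_comp 1"
proof
  fix x :: "'a J_mod_I'"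
  assume "x \<in> ZQ"
  then obtain a i b where x: "x = a * (cosetI (zv i) * b)" "a \<in> YQ" "b \<in> YQ"
    unfolding ZQ_def by blast
  then have "cosetI (zv i) * b \<in> Q_comp 1"
    using Q_comp_mult[OF cosetI_zv_odd[of i], of b 0] YQ_even by auto
  then show "x \<in> Q_comp 1"
    using x YQ_even Q_comp_even_odd_mult by blast
qed

lemma two_ne_0:
  assumes "CHAR('k::field) \<noteq> 2"
  shows "(2::'k) \<noteq> 0"
proof
  assume "(2::'k) = 0"
  then have "CHAR('k) dvd 2"
    by (metis of_nat_numeral of_nat_eq_0_iff_char_dvd)
  then have "CHAR('k) = 1"
    using assms two_is_prime_nat prime_nat_iff by blast
  then show False
    using of_nat_CHAR[where 'a = 'k] by simp
qed

text \<open>The product is three even multiplications applied to one variable \<open>z\<close>. The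
  linearized Jordan identity contains it twice and otherwise only terms with two even factors around
  \<open>z\<close>, so halving expresses it through \<open>ZQ\<close>.\<close>

lemma YQ_mult_ZQ:
  assumes "CHAR('k::{field,finite}) \<noteq> 2" and a: "a \<in> (YQ :: 'k J_mod_I' set)" and "x \<in> ZQ"
  shows "a * x \<in> Q.span ZQ"
proof -
  note comm = QJ.mult_commute
  obtain b i c where x: "x = b * (cosetI (zv i) * c)" and bc: "b \<in> YQ" "c \<in> YQ"
    using assms unfolding ZQ_def by blast
  define z :: "'k J_mod_I'" where "z = cosetI (zv i)"
  have z: "z \<in> Q_comp 1"
    by (simp add: z_def cosetI_zv_odd)
  have ev: "a \<in> Q_comp 0" "b \<in> Q_comp 0" "c \<in> Q_comp 0"
    using a bc YQ_even by auto
  have ZQ: "u * (z * v) \<in> ZQ" if "u \<in> YQ" "v \<in> YQ" for u v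
    using that unfolding ZQ_def z_def by blast
  \<comment> \<open>The operators of \<open>a\<close>, \<open>b\<close>, \<open>c\<close> commute on
    \<open>z\<close>, so the two terms rewritten in 1 and 2 have this same value.\<close>
  define X where "X = a * (b * (c * z))"
  have "((z * a) * c) * b = b * (c * (a * z))"
    by (metis comm)
  also have "\<dots> = b * (a * (c * z))"
    using Q_left_commute_odd[OF ev(3,1) z] by simp
  also have "\<dots> = X"
    unfolding X_def using Q_left_commute_odd[OF ev(2,1)] Q_comp_even_odd_mult[OF ev(3) z] by blast
  finally have 1: "((z * a) * c) * b = X" .
  have "((z * b) * c) * a = a * (c * (b * z))"
    by (metis comm)
  also have "\<dots> = X"
    unfolding X_def using Q_left_commute_odd[OF ev(3,2) z] by simp
  finally have 2: "((z * b) * c) * a = X" .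
  \<comment> \<open>The remaining terms are brought to the shape \<open>u * (z * v)\<close>; where
    \<open>u\<close> is missing, it is \<open>1\<close>.\<close>
  have 3: "((a * b) * c) * z = 1 * (z * ((a * b) * c))" "(z * a) * (c * b) = (c * b) * (z * a)"
    "c * z = z * c" "(z * b) * (c * a) = (c * a) * (z * b)"
    by (simp_all add: QJ.mult_unit_left comm)
  have "scaleQ 2 X = X + X"
    using Q.scale_left_distrib[of 1 1 X] by simp
  also have "\<dots> = (c * b) * (z * a) + (a * b) * (z * c) + (c * a) * (z * b)
      - 1 * (z * ((a * b) * c))"
    \<comment> \<open>With \<open>x = z\<close>, \<open>w = a\<close>, \<open>y = c\<close>,
      \<open>u = b\<close>, the first and third terms on the left are \<open>X\<close>; the middle
      one moves to the right with a minus sign.\<close>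
    using QJ.linearized_jordan_identity[OF two_ne_0[OF assms(1)], of z a c b]
    unfolding 1 2 3 by (simp add: algebra_simps)
  also have "\<dots> \<in> Q.span ZQ"
    by (intro Q.span_diff Q.span_add Q.span_base ZQ YQ_mult YQ_one a bc)
  finally have "scaleQ (1 / 2) (scaleQ 2 X) \<in> Q.span ZQ"
    by (rule Q.span_scale)
  then have "X \<in> Q.span ZQ"
    using two_ne_0[OF assms(1)] by simp
  then show ?thesis
    by (simp add: x X_def z_def comm)
qed

lemma Y_le_total: "Y_le is js \<or> Y_le js is"
proof -
  have "total (lenlex {(i, j::nat). i < j})"
    by (rule total_lenlex) (auto simp: total_on_def)
  then show ?thesis
    by (auto simp: Y_le_def total_on_def)
qed

text \<open>The two monomials around \<open>z\<close> may be exchanged because even multiplications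
  commute on odd elements, and since the order is total, one of the two arrangements satisfies
  \<open>Y_le\<close>.\<close>

lemma YQ_ZQ_subset: "YQ \<union> ZQ \<subseteq> cosetI ` (S_hat :: 'k::{field,finite} free_jordan set)"
proof
  fix x :: "'k J_mod_I'"
  assume "x \<in> YQ \<union> ZQ"
  then consider "x \<in> YQ" | "x \<in> ZQ" by blast
  then show "x \<in> cosetI ` S_hat"
  proof cases
    case 1
    obtain r k where "1 \<le> r" "\<forall>j<r. k j < CARD('k)" and x: "x = cosetI (Ymon r k)"
      using YQ_common[OF 1 1] by metis
    then have "Ymon r k \<in> (S_hat :: 'k free_jordan set)"
      unfolding S_hat_def by blast
    then show ?thesis
      unfolding x by (rule imageI)
  next
    case 2
    then obtain a i b where x: "x = a * (cosetI (zv i) * b)" "a \<in> YQ" "b \<in> YQ"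
      unfolding ZQ_def by blast
    then have x': "x = b * (cosetI (zv i) * a)"
      using Q_left_commute_odd[of a b "cosetI (zv i)"] YQ_even cosetI_zv_odd
      by (auto simp: QJ.mult_commute)
    from x(2,3) obtain r k l where r: "1 \<le> r" "\<forall>j<r. k j < CARD('k)" "\<forall>j<r. l j < CARD('k)"
      and ab: "a = cosetI (Ymon r k)" "b = cosetI (Ymon r l)"
      by (rule YQ_common)
    show ?thesis
    proof (cases "Y_le (Yvars r k) (Yvars r l)")
      case True
      then have "Ymon r k * (zv i * Ymon r l) \<in> (S_hat :: 'k free_jordan set)"
        using r unfolding S_hat_def by blast
      then show ?thesis
        unfolding x(1) ab times_J_mod_I'.abs_eq by (rule imageI)
    next
      case False
      then have "Ymon r l * (zv i * Ymon r k) \<in> (S_hat :: 'k free_jordan set)"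
        using r Y_le_total unfolding S_hat_def by blast
      then show ?thesis
        unfolding x' ab times_J_mod_I'.abs_eq by (rule imageI)
    qed
  qed
qed

text \<open>The span of \<open>YQ \<union> ZQ\<close> contains \<open>1\<close> and all variables
  and is closed under products, so induction over terms shows that it is everything.\<close>

lemma span_S_hat:
  assumes "CHAR('k::{field,finite}) \<noteq> 2"
  shows "Q.span (cosetI ` (S_hat :: 'k free_jordan set)) = UNIV"
proof -
  let ?U = "Q.span (YQ \<union> ZQ :: 'k J_mod_I' set)"
  have ZQ: "Q.span ZQ \<subseteq> ?U"
    by (rule Q.span_mono) simp
  have "u * v \<in> ?U" if "u \<in> YQ \<union> ZQ" "v \<in> YQ \<union> ZQ" for u v :: "'k J_mod_I'"
  proof -
    from that consider "u \<in> YQ" "v \<in> YQ" | "u \<in> YQ" "v \<in> ZQ" | "u \<in> ZQ" "v \<in> YQ"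
      | "u \<in> ZQ" "v \<in> ZQ"
      by auto
    then show ?thesis
    proof cases
      case 1
      then show ?thesis by (simp add: YQ_mult Q.span_base)
    next
      case 2
      then show ?thesis using YQ_mult_ZQ[OF assms] ZQ by blast
    next
      case 3
      then show ?thesis using YQ_mult_ZQ[OF assms] ZQ QJ.mult_commute[of u v] by auto
    next
      case 4
      then have "u * v = 0"
        using Q_odd_odd ZQ_odd by blast
      then show ?thesis by (simp add: Q.span_zero)
    qed
  qed
  then have mult: "u * v \<in> ?U" if "u \<in> ?U" "v \<in> ?U" for u v
    using QJ.mult_span[OF _ Q.subspace_span that] by blast
  have "cosetI (abs_free_jordan t) \<in> ?U" for t :: "'k jterm"
  proof (induction t)
    case (TY i)
    let ?k = "\<lambda>j. if j < i then 0 else 1 :: nat"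
    \<comment> \<open>All exponents below \<open>i\<close> are 0; written as a padding of the empty
      monomial, this factor is 1 and only the variable of index \<open>i\<close> survives.\<close>
    have "Ymon i ?k = (Ymon i (\<lambda>j. if j < 0 then 0 else 0) :: 'k free_jordan)"
      by (rule Ymon_cong) simp
    also have "\<dots> = Ymon 0 (\<lambda>_. 0)"
      by (rule Ymon_pad) simp
    finally have "Ymon (Suc i) ?k = (yv i :: 'k free_jordan)"
      by (simp add: Ymon_Suc lpow_Suc FJ.mult_unit_left)
    then have "cosetI (yv i) \<in> (YQ :: 'k J_mod_I' set)"
      unfolding YQ_def by (metis (mono_tags, lifting) mem_Collect_eq)
    then show ?case by (simp add: Q.span_base flip: yv.abs_eq)
  next
    case (TZ i)
    have "1 * (cosetI (zv i) * 1) \<in> (ZQ :: 'k J_mod_I' set)"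
      using YQ_one unfolding ZQ_def by blast
    then show ?case
      by (simp add: QJ.mult_unit_left QJ.mult_unit_right Q.span_base flip: zv.abs_eq)
  next
    case TOne
    then show ?case
      by (simp add: YQ_one Q.span_base flip: one_free_jordan_def one_J_mod_I'.abs_eq)
  next
    case TZero
    then show ?case
      by (simp add: Q.span_zero flip: zero_free_jordan_def zero_J_mod_I'.abs_eq)
  next
    case (TAdd s t)
    then show ?case
      by (simp add: Q.span_add flip: plus_free_jordan.abs_eq plus_J_mod_I'.abs_eq)
  next
    case (TScale c s)
    then show ?case
      by (simp add: Q.span_scale flip: scaleJ.abs_eq scaleQ.abs_eq)
  next
    case (TMult s t)
    then show ?case
      by (simp add: mult flip: times_free_jordan.abs_eq times_J_mod_I'.abs_eq)
  qed
  then have "u \<in> ?U" for u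
    by (metis cosetI_surj Quotient_free_jordan Quotient_abs_rep)
  then show ?thesis
    using Q.span_mono[OF YQ_ZQ_subset[where 'k = 'k]] by blast
qed


section \<open>Coefficient functionals over a finite field\<close>

text \<open>Multiplication by \<open>x\<close> permutes the nonzero elements; comparing their
  products gives the claim.\<close>

lemma finite_field_power_card_minus_1:
  assumes "x \<noteq> (0::'k::{field,finite})"
  shows "x ^ (CARD('k) - 1) = 1"
proof -
  have "bij_betw ((*) x) (UNIV - {0}) (UNIV - {0})"
    by (rule bij_betw_byWitness[where f' = "\<lambda>y. y / x"]) (use assms in auto)
  then have "(\<Prod>y\<in>UNIV - {0}. x * y) = \<Prod>(UNIV - {0})"
    by (rule prod.reindex_bij_betw)
  moreover have "(\<Prod>y\<in>UNIV - {0}. x * y) = x ^ (CARD('k) - 1) * \<Prod>(UNIV - {0})"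
    by (simp add: prod.distrib card_Diff_singleton)
  moreover have "\<Prod>(UNIV - {0 :: 'k}) \<noteq> 0"
    by simp
  ultimately show ?thesis by simp
qed

lemma finite_field_power_card: "x ^ CARD('k) = (x::'k::{field,finite})"
proof (cases "x = 0")
  case False
  then show ?thesis
    using finite_field_power_card_minus_1[OF False]
    by (metis mult.right_neutral power_minus_mult zero_less_card_finite mult.commute)
qed (simp add: power_0_left)

text \<open>The polynomial \<open>1 - (X - x)^(q - 1)\<close> is the Lagrange basis polynomial of the point \<open>x\<close>.\<close>

definition dual_weight :: "nat \<Rightarrow> 'k::{field,finite} \<Rightarrow> 'k"
  where "dual_weight k x = coeff (1 - [:- x, 1:] ^ (CARD('k) - 1)) k"

text \<open>Interpolating \<open>X^n\<close> at all \<open>q\<close> points is exact because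
  \<open>n < q\<close>: both polynomials have degree below \<open>q\<close> and agree everywhere.
  Their coefficients at \<open>k\<close> are compared.\<close>

lemma sum_dual_weight:
  assumes "n < CARD('k::{field,finite})"
  shows "(\<Sum>x\<in>UNIV. dual_weight k x * x ^ n) = (if k = n then 1 else (0::'k))"
proof -
  define L :: "'k \<Rightarrow> 'k poly" where "L x = 1 - [:- x, 1:] ^ (CARD('k) - 1)" for x
  have L: "poly (L x) y = (if x = y then 1 else 0)" for x y
    using finite_field_power_card_minus_1[of "y - x"] card_mono[of UNIV "{0, 1 :: 'k}"]
    by (auto simp: L_def poly_power power_0_left)
  have deg: "degree (L x) < CARD('k)" for x
  proof -
    have "degree (L x) \<le> CARD('k) - 1"
      unfolding L_def by (rule degree_diff_le) (simp_all add: degree_linear_power)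
    then show ?thesis
      using zero_less_card_finite[where 'a = 'k] by linarith
  qed
  have "(\<Sum>x\<in>UNIV. smult (x ^ n) (L x)) = monom 1 n"
  proof (rule poly_eqI_degree[where A = UNIV])
    have "degree (smult (x ^ n) (L x)) \<le> CARD('k) - 1" for x
      using degree_smult_le[of "x ^ n" "L x"] deg[of x] by linarith
    then have "degree (\<Sum>x\<in>UNIV. smult (x ^ n) (L x)) \<le> CARD('k) - 1"
      by (intro degree_sum_le) simp_all
    then show "degree (\<Sum>x\<in>UNIV. smult (x ^ n) (L x)) < CARD('k)"
      using zero_less_card_finite[where 'a = 'k] by linarith
  qed (use assms in \<open>simp_all add: poly_sum L poly_monom degree_monom_eq if_distrib cong: if_cong\<close>)
  from arg_cong[OF this, of "\<lambda>p. coeff p k"] show ?thesis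
    by (simp add: coeff_sum dual_weight_def L_def mult.commute)
qed

text \<open>Extensional functions stand for tuples of length \<open>R\<close>, which keeps sums over
  them finite.\<close>

abbreviation points :: "nat \<Rightarrow> (nat \<Rightarrow> 'k::{field,finite}) set"
  where "points R \<equiv> PiE {..<R} (\<lambda>_. UNIV)"

definition Ypow :: "nat \<Rightarrow> (nat \<Rightarrow> nat) \<Rightarrow> (nat \<Rightarrow> 'k::field) \<Rightarrow> 'k"
  where "Ypow R k x = (\<Prod>j<R. x j ^ k j)"

text \<open>Dual to \<open>Ypow R k\<close>: summing against it extracts the coefficient of that
  monomial.\<close>

definition Yweight :: "nat \<Rightarrow> (nat \<Rightarrow> nat) \<Rightarrow> (nat \<Rightarrow> 'k::{field,finite}) \<Rightarrow> 'k"
  where "Yweight R k x = (\<Prod>j<R. dual_weight (k j) (x j))"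

lemma Ypow_0: "Ypow R (\<lambda>_. 0) x = 1"
  by (simp add: Ypow_def)

lemma Ypow_add: "Ypow R k x * Ypow R l x = Ypow R (\<lambda>j. k j + l j) x"
  by (simp add: Ypow_def prod.distrib power_add)

text \<open>The sum over tuples factors into one sum per variable.\<close>

lemma sum_Yweight_Ypow:
  assumes "\<forall>j<R. m j < CARD('k)"
  shows "(\<Sum>x\<in>points R. Yweight R k x * Ypow R m x) =
    (if \<forall>j<R. k j = m j then 1 else (0::'k::{field,finite}))"
proof -
  have "(\<Sum>x\<in>points R. Yweight R k x * Ypow R m x) =
      (\<Sum>x\<in>points R. \<Prod>j<R. dual_weight (k j) (x j) * x j ^ m j :: 'k)"
    by (simp add: Yweight_def Ypow_def prod.distrib)
  also have "\<dots> = (\<Prod>j<R. \<Sum>t\<in>UNIV. dual_weight (k j) t * t ^ m j)"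
    by (rule prod_sum_PiE[symmetric]) auto
  also have "\<dots> = (\<Prod>j<R. if k j = m j then 1 else 0)"
    using assms by (intro prod.cong) (auto simp: sum_dual_weight)
  also have "\<dots> = (if \<forall>j<R. k j = m j then 1 else 0)"
    by (auto intro: prod.neutral)
  finally show ?thesis .
qed

lemma sum_Yweight:
  "(\<Sum>x\<in>points R. Yweight R k x) = (if \<forall>j<R. k j = 0 then 1 else (0::'k::{field,finite}))"
  using sum_Yweight_Ypow[where m = "\<lambda>_. 0", of R k, where 'k = 'k] by (simp add: Ypow_0)


section \<open>Graded substitutions\<close>

text \<open>The definite description is justified by \<open>graded_subst_exists\<close> once 2 is
  nonzero.\<close>

definition ut_subst ::
  "(nat \<Rightarrow> 'k::field) \<Rightarrow> (nat \<Rightarrow> 'k) \<Rightarrow> (nat \<Rightarrow> 'k) \<Rightarrow> 'k free_jordan \<Rightarrow> 'k^2^2"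
  where "ut_subst x y c = (THE \<phi>. graded_subst \<phi> \<and>
    (\<forall>j. \<phi> (yv j) = ut (x j) (y j) 0) \<and> (\<forall>j. \<phi> (zv j) = ut 0 0 (c j)))"

context
  assumes two: "(2::'k::field) \<noteq> 0"
begin

lemma ut_subst:
  "graded_subst (ut_subst x y (c :: nat \<Rightarrow> 'k))"
  "ut_subst x y c (yv j) = ut (x j) (y j) 0" "ut_subst x y c (zv j) = ut 0 0 (c j)"
proof -
  have "\<exists>!\<phi>. graded_subst \<phi> \<and> (\<forall>j. \<phi> (yv j) = ut (x j) (y j) 0) \<and> (\<forall>j. \<phi> (zv j) = ut 0 0 (c j))"
    by (rule graded_subst_exists[OF two]) (auto simp: UJ2_comp_eq[OF two])
  from theI'[OF this] show "graded_subst (ut_subst x y c)"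
    "ut_subst x y c (yv j) = ut (x j) (y j) 0" "ut_subst x y c (zv j) = ut 0 0 (c j)"
    by (simp_all add: ut_subst_def)
qed

lemma graded_subst_simps:
  fixes \<phi> :: "'k free_jordan \<Rightarrow> 'k^2^2"
  assumes "graded_subst \<phi>"
  shows "\<phi> (f + g) = \<phi> f + \<phi> g" "\<phi> (d *J f) = mscale d (\<phi> f)" "\<phi> (f - g) = \<phi> f - \<phi> g"
    "\<phi> (f * g) = jprod (\<phi> f) (\<phi> g)" "\<phi> 1 = ut 1 1 0" "\<phi> 0 = 0"
proof -
  interpret Vector_Spaces.linear scaleJ mscale \<phi>
    using assms by (simp add: graded_subst_def unital_alg_hom_def)
  show "\<phi> (f + g) = \<phi> f + \<phi> g" "\<phi> (d *J f) = mscale d (\<phi> f)" "\<phi> (f - g) = \<phi> f - \<phi> g" "\<phi> 0 = 0"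
    by (rule add scale diff zero)+
  show "\<phi> (f * g) = jprod (\<phi> f) (\<phi> g)" "\<phi> 1 = ut 1 1 0"
    using assms by (simp_all add: graded_subst_def unital_alg_hom_def ut_one)
qed

lemma graded_subst_lpow:
  fixes \<phi> :: "'k free_jordan \<Rightarrow> 'k^2^2"
  assumes "graded_subst \<phi>" "\<phi> f = ut a b 0"
  shows "\<phi> (lpow f n) = ut (a ^ n) (b ^ n) 0"
  by (induction n) (simp_all add: lpow_Suc graded_subst_simps[OF assms(1)] assms(2) jprod_ut[OF two]
      mult.commute)

lemma ut_subst_Ymon: "ut_subst x y (c :: nat \<Rightarrow> 'k) (Ymon r k) = ut (Ypow r k x) (Ypow r k y) 0"
  by (induction r)
    (simp_all add: Ymon_Suc Ypow_def graded_subst_simps[OF ut_subst(1)]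
      graded_subst_lpow[OF ut_subst(1) ut_subst(2)] jprod_ut[OF two])

text \<open>Each of the two multiplications scales the corner by the mean of two diagonal entries;
  the two halves give the 4.\<close>

lemma ut_subst_YzY:
  "ut_subst x y (c :: nat \<Rightarrow> 'k) (Ymon r k * (zv i * Ymon r l)) =
    ut 0 0 (c i / 4 * ((Ypow r k x + Ypow r k y) * (Ypow r l x + Ypow r l y)))"
proof -
  have "(4::'k) = 2 * 2"
    by simp
  then have "a / 2 * b / 2 = a * b / 4" for a b :: 'k
    by simp
  then show ?thesis
    by (simp add: graded_subst_simps[OF ut_subst(1)] ut_subst_Ymon ut_subst(3) jprod_ut[OF two]
        mult_ac)
qed

text \<open>A substitution carries each \<open>J_comp d\<close> into \<open>UJ2_comp d\<close>, so
  the composite still sends every variable to a matrix of the right parity.\<close>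

lemma graded_subst_comp:
  fixes \<phi> :: "'k free_jordan \<Rightarrow> 'k^2^2"
  assumes \<phi>: "graded_subst \<phi>" and \<psi>: "graded_endo \<psi>"
  shows "graded_subst (\<phi> \<circ> \<psi>)"
proof -
  interpret uj: unital_jordan_algebra mscale jprod "mat 1 :: 'k^2^2"
    by (rule jprod_jordan[OF two])
  have "\<phi> f \<in> UJ2_comp d" if "f \<in> J_comp d" for f d
  proof (rule uj.hom_J_comp[where C = UJ2_comp, OF _ _ _ _ _ _ that])
    show "M2.subspace (UJ2_comp d :: ('k^2^2) set)" for d
      by (simp add: UJ2_comp_def M2.subspace_span)
    show "jprod u v \<in> UJ2_comp (d + e)"
      if "u \<in> UJ2_comp d" "v \<in> UJ2_comp e" for d e and u v :: "'k^2^2"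
      using that by (cases d; cases e) (auto simp: UJ2_comp_eq[OF two] jprod_ut[OF two], blast+)
  qed (use \<phi> in \<open>auto simp: graded_subst_def UJ2_comp_eq[OF two] ut_one\<close>)
  moreover have "\<psi> f \<in> J_comp d" if "f \<in> J_comp d" for f d
    using that \<psi> unfolding graded_endo_def by blast
  ultimately have "\<phi> (\<psi> f) \<in> UJ2_comp d" if "f \<in> J_comp d" for f d
    using that by blast
  then have "(\<phi> \<circ> \<psi>) (yv i) \<in> UJ2_comp 0" "(\<phi> \<circ> \<psi>) (zv i) \<in> UJ2_comp 1" for i
    by (simp_all add: J_comp_monomial monomial_deg.even monomial_deg.odd)
  moreover have "Vector_Spaces.linear scaleJ mscale (\<phi> \<circ> \<psi>)"
    using \<phi> \<psi> Vector_Spaces.linear_compose[of scaleJ scaleJ \<psi> mscale \<phi>]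
    by (simp add: graded_subst_def graded_endo_def unital_alg_hom_def)
  ultimately show ?thesis
    using \<phi> \<psi> by (auto simp only: graded_subst_def graded_endo_def unital_alg_hom_def comp_apply image_subset_iff)
qed

text \<open>The set is an intersection of kernels, and the substitutions are closed under
  precomposition with graded endomorphisms.\<close>

lemma T2_ideal_T_Cla: "T2_ideal (T_Cla :: 'k free_jordan set)"
proof -
  interpret uj: unital_jordan_algebra mscale jprod "mat 1 :: 'k^2^2"
    by (rule jprod_jordan[OF two])
  have "FJ.subspace (T_Cla :: 'k free_jordan set)"
    by (auto simp: FJ.subspace_def T_Cla_def graded_subst_simps)
  moreover have "\<psi> f \<in> T_Cla" if "f \<in> T_Cla" "graded_endo \<psi>" for f :: "'k free_jordan" and \<psi>
    using that graded_subst_comp[OF _ that(2)] by (fastforce simp: T_Cla_def)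
  ultimately show ?thesis
    by (auto simp: T2_ideal_def J_ideal_def T_Cla_def graded_subst_simps uj.mult_zero_left
        uj.mult_zero_right)
qed

end

text \<open>By minimality only the generators are tested; on diagonals and corners they become
  scalar identities, the last one being \<open>x^q = x\<close>.\<close>

lemma I'_subset_T_Cla:
  assumes two: "(2::'k::{field,finite}) \<noteq> 0"
  shows "(I' :: 'k free_jordan set) \<subseteq> T_Cla"
  unfolding I'_def
proof (rule T2_ideal_gen_least(2)[OF T2_ideal_T_Cla[OF two]])
  have "\<phi> g = 0" if "g \<in> I_gens" "graded_subst \<phi>" for g and \<phi> :: "'k free_jordan \<Rightarrow> 'k^2^2"
  proof -
    have "\<exists>a b. \<phi> (yv i) = ut a b 0" "\<exists>c. \<phi> (zv i) = ut 0 0 c" for i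
      using that(2) by (auto simp: graded_subst_def UJ2_comp_eq[OF two])
    then obtain a b c where \<phi>: "\<And>i. \<phi> (yv i) = ut (a i) (b i) 0" "\<And>i. \<phi> (zv i) = ut 0 0 (c i)"
      by metis
    show ?thesis
      using that(1) unfolding I_gens_def
      by (auto simp: assoc_def graded_subst_simps[OF two that(2)] \<phi> jprod_ut[OF two] ut_zero[symmetric]
          graded_subst_lpow[OF two that(2) \<phi>(1)] finite_field_power_card mult_ac)
  qed
  then show "I_gens \<subseteq> (T_Cla :: 'k free_jordan set)"
    unfolding T_Cla_def by blast
qed


section \<open>Linear independence\<close>

lemma Y_le_antisym:
  assumes "Y_le is js" "Y_le js is"
  shows "is = js"
proof -
  have "asym (lenlex {(i, j::nat). i < j})"
    by (rule asym_lenlex) (auto intro: asymI)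
  then show ?thesis
    using assms by (auto simp: Y_le_def asym_on_def)
qed

lemma Y_le_Nil: "Y_le is [] \<longleftrightarrow> is = []"
  using lenlex_length[of "is" "[]"] by (auto simp: Y_le_def)

lemma Yvars_eq_iff: "Yvars R k = Yvars R l \<longleftrightarrow> (\<forall>j<R. k j = l j)"
proof
  assume eq: "Yvars R k = Yvars R l"
  \<comment> \<open>The exponent of a variable is recovered as its number of occurrences.\<close>
  have count: "length (filter (\<lambda>i. i = j) (Yvars R k)) = (if j < R then k j else 0)" for j k
  proof (induction R)
    case 0
    then show ?case by (simp add: Yvars_def)
  next
    case (Suc R)
    then show ?case by (auto simp: Yvars_Suc filter_replicate less_Suc_eq)
  qed
  show "\<forall>j<R. k j = l j"
    using count[of _ k] count[of _ l] unfolding eq by (metis)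
qed (auto intro: Yvars_cong)

lemma Yvars_eq_Nil_iff: "Yvars R k = [] \<longleftrightarrow> (\<forall>j<R. k j = 0)"
  by (auto simp: Yvars_def)

text \<open>A single \<open>R\<close> for all elements: every finite subset of \<open>S_hat\<close>
  lies in such a set, so all exponents refer to the same variables.\<close>

definition S_hat_upto :: "nat \<Rightarrow> 'k::{field,finite} free_jordan set"
  where "S_hat_upto R =
    {Ymon R k | k. \<forall>j<R. k j < CARD('k)} \<union>
    {Ymon R k * (zv i * Ymon R l) | k l i. (\<forall>j<R. k j < CARD('k)) \<and> (\<forall>j<R. l j < CARD('k)) \<and>
       Y_le (Yvars R k) (Yvars R l)}"

lemma S_hat_upto_mono:
  assumes "r \<le> R"
  shows "S_hat_upto r \<subseteq> (S_hat_upto R :: 'k::{field,finite} free_jordan set)"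
proof
  fix g :: "'k free_jordan"
  let ?p = "\<lambda>k j. if j < r then k j else 0 :: nat"
  have p: "\<forall>j<R. ?p k j < CARD('k)" if "\<forall>j<r. k j < CARD('k)" for k
    using that by simp
  assume "g \<in> S_hat_upto r"
  then consider k where "\<forall>j<r. k j < CARD('k)" "g = Ymon r k"
    | k l i where "\<forall>j<r. k j < CARD('k)" "\<forall>j<r. l j < CARD('k)" "Y_le (Yvars r k) (Yvars r l)"
      "g = Ymon r k * (zv i * Ymon r l)"
    unfolding S_hat_upto_def by blast
  then show "g \<in> S_hat_upto R"
  proof cases
    case 1
    then have "g = Ymon R (?p k)"
      by (simp add: Ymon_pad[OF assms])
    then show ?thesis
      using p[OF 1(1)] unfolding S_hat_upto_def by blast
  next
    case 2
    then have "g = Ymon R (?p k) * (zv i * Ymon R (?p l))" "Y_le (Yvars R (?p k)) (Yvars R (?p l))"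
      by (simp_all add: Ymon_pad[OF assms] Yvars_pad[OF assms])
    then show ?thesis
      using p[OF 2(1)] p[OF 2(2)] unfolding S_hat_upto_def by blast
  qed
qed

lemma finite_subset_S_hat_upto:
  assumes "finite F" "F \<subseteq> S_hat"
  shows "\<exists>R. F \<subseteq> S_hat_upto R"
  using assms
proof (induction F rule: finite_induct)
  case (insert g F)
  then obtain R where R: "F \<subseteq> S_hat_upto R"
    by blast
  obtain r where "g \<in> S_hat_upto r"
    using insert.prems unfolding S_hat_def S_hat_upto_def by blast
  then have "insert g F \<subseteq> S_hat_upto (max r R)"
    using R S_hat_upto_mono[of r "max r R"] S_hat_upto_mono[of R "max r R"] by auto
  then show ?case ..
qed simp

text \<open>The coefficient of \<open>x^k y^l\<close> in the entry \<open>(1, i)\<close> of the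
  value of \<open>f\<close>, as a function of the diagonal entries \<open>x j\<close>,
  \<open>y j\<close>. The diagonal entry \<open>i = 1\<close> detects monomials free of odd
  variables, the corner \<open>i = 2\<close> those containing one.\<close>

definition coeff_functional ::
  "nat \<Rightarrow> (nat \<Rightarrow> nat) \<Rightarrow> (nat \<Rightarrow> nat) \<Rightarrow> (nat \<Rightarrow> 'k::{field,finite}) \<Rightarrow> 2 \<Rightarrow> 'k free_jordan \<Rightarrow> 'k"
  where "coeff_functional R k l c i f =
    (\<Sum>x\<in>points R. \<Sum>y\<in>points R. Yweight R k x * Yweight R l y * ut_subst x y c f $ 1 $ i)"

lemma sum_points_mult:
  "(\<Sum>x\<in>points R. \<Sum>y\<in>points R. Yweight R k x * Yweight R l y * (f x * g y)) =
    (\<Sum>x\<in>points R. Yweight R k x * f x) * (\<Sum>y\<in>points R. Yweight R l y * g y)"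
  by (simp add: sum_product mult_ac)

section \<open>Values of the coefficient functionals and elimination of coefficients\<close>

context
  assumes two: "(2::'k::{field,finite}) \<noteq> 0"
begin

text \<open>The functional is a weighted sum of values under graded substitutions, hence linear and
  zero on identities.\<close>

lemma coeff_functional_combination:
  fixes F :: "'k free_jordan set"
  assumes "finite F" "(\<Sum>g\<in>F. a g *J g) \<in> T_Cla"
  shows "(\<Sum>g\<in>F. a g * coeff_functional R k l c i g) = 0"
proof -
  have "(\<Sum>g\<in>F. a g * ut_subst x y c g $ 1 $ i) = 0" for x y
  proof -
    have "(\<Sum>g\<in>F. a g * ut_subst x y c g $ 1 $ i) = ut_subst x y c (\<Sum>g\<in>F. a g *J g) $ 1 $ i"
      using assms(1)
      by (induction F rule: finite_induct)
        (simp_all add: graded_subst_simps[OF two ut_subst(1)[OF two]] mscale_def)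
    moreover have "ut_subst x y c (\<Sum>g\<in>F. a g *J g) = 0"
      using assms(2) ut_subst(1)[OF two, of x y c] unfolding T_Cla_def by blast
    ultimately show ?thesis by simp
  qed
  then have "0 = (\<Sum>x\<in>points R. \<Sum>y\<in>points R. Yweight R k x * Yweight R l y *
      (\<Sum>g\<in>F. a g * ut_subst x y c g $ 1 $ i))"
    by simp
  also have "\<dots> = (\<Sum>x\<in>points R. \<Sum>g\<in>F. \<Sum>y\<in>points R.
      Yweight R k x * Yweight R l y * (a g * ut_subst x y c g $ 1 $ i))"
    unfolding sum_distrib_left by (intro sum.cong[OF HOL.refl] sum.swap)
  also have "\<dots> = (\<Sum>g\<in>F. \<Sum>x\<in>points R. \<Sum>y\<in>points R.
      Yweight R k x * Yweight R l y * (a g * ut_subst x y c g $ 1 $ i))"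
    by (rule sum.swap)
  also have "\<dots> = (\<Sum>g\<in>F. a g * coeff_functional R k l c i g)"
    unfolding coeff_functional_def sum_distrib_left
    by (intro sum.cong HOL.refl) (simp add: mult_ac)
  finally show ?thesis by simp
qed

text \<open>The alternative \<open>a h = 0\<close> allows elimination in stages: a functional may
  also see elements whose coefficients are already known to vanish.\<close>

lemma coeff_functional_isolate:
  fixes F :: "'k free_jordan set"
  assumes "finite F" "(\<Sum>g\<in>F. a g *J g) \<in> T_Cla" "g \<in> F"
    and "\<And>h. h \<in> F \<Longrightarrow> h \<noteq> g \<Longrightarrow> a h = 0 \<or> coeff_functional R k l c i h = 0"
    and "coeff_functional R k l c i g \<noteq> 0"
  shows "a g = 0"
proof -
  have "(\<Sum>h\<in>F. a h * coeff_functional R k l c i h) = a g * coeff_functional R k l c i g"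
  proof (subst sum.remove[OF assms(1,3)])
    have "(\<Sum>h\<in>F - {g}. a h * coeff_functional R k l c i h) = 0"
      by (rule sum.neutral) (use assms(4) in fastforce)
    then show "a g * coeff_functional R k l c i g +
        (\<Sum>h\<in>F - {g}. a h * coeff_functional R k l c i h) = a g * coeff_functional R k l c i g"
      by simp
  qed
  then show ?thesis
    using coeff_functional_combination[OF assms(1,2)] assms(5) by simp
qed

text \<open>The diagonal entry depends on \<open>x\<close> alone, so the exponent 0 is taken in
  \<open>y\<close>; the corner of a diagonal matrix is 0.\<close>

lemma coeff_functional_Ymon:
  assumes "\<forall>j<R. m j < CARD('k)"
  shows "coeff_functional R k (\<lambda>_. 0) c 1 (Ymon R m :: 'k free_jordan) =
      (if \<forall>j<R. k j = m j then 1 else 0)"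
    "coeff_functional R k l c 2 (Ymon R m :: 'k free_jordan) = 0"
proof -
  have "coeff_functional R k (\<lambda>_. 0) c 1 (Ymon R m :: 'k free_jordan) =
      (\<Sum>x\<in>points R. Yweight R k x * Ypow R m x) * (\<Sum>y\<in>points R. Yweight R (\<lambda>_. 0) y * 1)"
    unfolding sum_points_mult[symmetric] coeff_functional_def by (simp add: ut_subst_Ymon[OF two])
  then show "coeff_functional R k (\<lambda>_. 0) c 1 (Ymon R m :: 'k free_jordan) =
      (if \<forall>j<R. k j = m j then 1 else 0)"
    using sum_Yweight_Ypow[OF assms] by (simp add: sum_Yweight)
  show "coeff_functional R k l c 2 (Ymon R m :: 'k free_jordan) = 0"
    by (simp add: coeff_functional_def ut_subst_Ymon[OF two])
qed

text \<open>The four summands come from expanding \<open>(x^m + y^m) (x^n + y^n)\<close>. Exponents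
  in \<open>m + n\<close> may reach \<open>q\<close> or more, so \<open>\<sigma>\<close> stays an
  unevaluated sum.\<close>

lemma coeff_functional_YzY:
  assumes m: "\<forall>j<R. m j < CARD('k)" and n: "\<forall>j<R. n j < CARD('k)"
  defines "\<delta> \<equiv> \<lambda>k l. if \<forall>j<R. k j = l j then 1 else 0 :: 'k"
    and "\<sigma> \<equiv> \<lambda>k. \<Sum>x\<in>points R. Yweight R k x * Ypow R (\<lambda>j. m j + n j) x :: 'k"
  shows "coeff_functional R k l c 1 (Ymon R m * (zv i * Ymon R n) :: 'k free_jordan) = 0"
    "coeff_functional R k l c 2 (Ymon R m * (zv i * Ymon R n)) = c i / 4 *
      (\<sigma> k * \<delta> l (\<lambda>_. 0) + \<delta> k m * \<delta> l n + \<delta> k n * \<delta> l m + \<delta> k (\<lambda>_. 0) * \<sigma> l)"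
proof -
  show "coeff_functional R k l c 1 (Ymon R m * (zv i * Ymon R n) :: 'k free_jordan) = 0"
    by (simp add: coeff_functional_def ut_subst_YzY[OF two])
  let ?s = "\<lambda>f g. \<Sum>x\<in>points R. \<Sum>y\<in>points R. Yweight R k x * Yweight R l y * (f x * g y) :: 'k"
  have "coeff_functional R k l c 2 (Ymon R m * (zv i * Ymon R n)) = c i / 4 *
      (?s (Ypow R (\<lambda>j. m j + n j)) (\<lambda>_. 1) + ?s (Ypow R m) (Ypow R n)
      + ?s (Ypow R n) (Ypow R m) + ?s (\<lambda>_. 1) (Ypow R (\<lambda>j. m j + n j)))"
    unfolding coeff_functional_def ut_subst_YzY[OF two] ut_nth Ypow_add[symmetric]
      sum.distrib[symmetric] sum_distrib_left
    by (intro sum.cong HOL.refl) (simp add: ring_distribs mult_ac)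
  then show "coeff_functional R k l c 2 (Ymon R m * (zv i * Ymon R n)) = c i / 4 *
      (\<sigma> k * \<delta> l (\<lambda>_. 0) + \<delta> k m * \<delta> l n + \<delta> k n * \<delta> l m + \<delta> k (\<lambda>_. 0) * \<sigma> l)"
    unfolding sum_points_mult sum_Yweight_Ypow[OF m] sum_Yweight_Ypow[OF n]
    by (simp add: sum_Yweight \<delta>_def \<sigma>_def)
qed

text \<open>Coefficients are eliminated in three stages: no odd variable, then a nonzero first
  exponent \<open>k\<close>, then \<open>k = 0\<close>.\<close>

lemma S_hat_independent_mod_T_Cla:
  fixes F :: "'k free_jordan set"
  assumes F: "finite F" "F \<subseteq> S_hat" and sum: "(\<Sum>g\<in>F. a g *J g) \<in> T_Cla" and "g \<in> F"
  shows "a g = 0"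
proof -
  obtain R where R: "F \<subseteq> S_hat_upto R"
    using finite_subset_S_hat_upto[OF F] by blast
  define bd where "bd k \<longleftrightarrow> (\<forall>j<R. k j < CARD('k))" for k :: "nat \<Rightarrow> nat"
  \<comment> \<open>\<open>Ymon R\<close> only sees exponents below \<open>R\<close>, so agreement
    there replaces equality.\<close>
  define eq where "eq k l \<longleftrightarrow> (\<forall>j<R. k j = l j)" for k l :: "nat \<Rightarrow> nat"
  define le where "le k l \<longleftrightarrow> Y_le (Yvars R k) (Yvars R l)" for k l
  have eq_Ymon: "Ymon R k = Ymon R l" if "eq k l" for k l
    using that Ymon_cong unfolding eq_def by blast
  have eq_sym: "eq k l \<longleftrightarrow> eq l k" for k l
    by (auto simp: eq_def)
  have eq_trans: "eq k l \<Longrightarrow> eq l m \<Longrightarrow> eq k m" for k l m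
    by (auto simp: eq_def)
  have [simp]: "eq k k" for k
    by (simp add: eq_def)
  have le_antisym: "eq k l" if "le k l" "le l k" for k l
    using Y_le_antisym that Yvars_eq_iff[of R k l] unfolding le_def eq_def by blast
  have le_eq: "le k l \<longleftrightarrow> le k' l'" if "eq k k'" "eq l l'" for k k' l l'
    using that Yvars_eq_iff[of R] unfolding le_def eq_def by metis
  have le_0: "eq k (\<lambda>_. 0)" if "le k l" "eq l (\<lambda>_. 0)" for k l
    using that Y_le_Nil Yvars_eq_Nil_iff[of R] unfolding le_def eq_def by metis
  have cases_F: thesis
    if "h \<in> F" "\<And>m. bd m \<Longrightarrow> h = Ymon R m \<Longrightarrow> thesis"
      "\<And>m n i. bd m \<Longrightarrow> bd n \<Longrightarrow> le m n \<Longrightarrow> h = Ymon R m * (zv i * Ymon R n) \<Longrightarrow> thesis"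
    for h thesis
    using that R unfolding S_hat_upto_def bd_def le_def by blast
  have four: "(4::'k) \<noteq> 0"
    using two mult_eq_0_iff[of "2::'k" 2] by simp
  note isolate = coeff_functional_isolate[OF F(1) sum]
  \<comment> \<open>First stage: the entry \<open>(1, 1)\<close> vanishes on everything containing
    an odd variable, and the coefficient of \<open>x^k\<close> singles out
    \<open>Ymon R k\<close>.\<close>
  have "a h = 0" if h: "h \<in> F" "h = Ymon R k" "bd k" for h k
  proof (rule isolate[OF h(1)])
    have val: "coeff_functional R k (\<lambda>_. 0) (\<lambda>_. 0) 1 (Ymon R m :: 'k free_jordan) =
        (if eq k m then 1 else 0)" if "bd m" for m
      using coeff_functional_Ymon(1) that unfolding bd_def eq_def by blast
    show "coeff_functional R k (\<lambda>_. 0) (\<lambda>_. 0) 1 h \<noteq> 0"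
      using h by (simp add: val)
    show "a h' = 0 \<or> coeff_functional R k (\<lambda>_. 0) (\<lambda>_. 0) 1 h' = 0" if "h' \<in> F" "h' \<noteq> h" for h'
      using that(1)
    proof (rule cases_F)
      fix m assume m: "bd m" "h' = Ymon R m"
      then have "\<not> eq k m"
        using eq_Ymon h(2) that(2) by metis
      then show ?thesis
        using m by (simp add: val)
    qed (simp add: coeff_functional_YzY(1) bd_def)
  qed
  note Y_zero = this
  \<comment> \<open>Second stage: by the order \<open>l\<close> is nonzero along with
    \<open>k\<close>, so both \<open>\<sigma>\<close> terms drop out of the coefficient of
    \<open>x^k y^l\<close>.\<close>
  have "a h = 0" if h: "h \<in> F" "h = Ymon R k * (zv i * Ymon R l)" "bd k" "bd l" "le k l"
    and k: "\<not> eq k (\<lambda>_. 0)" for h k l i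
  proof (rule isolate[OF h(1)])
    \<comment> \<open>The other odd variables are sent to 0, so only elements containing the one of
      index \<open>i\<close> are seen.\<close>
    let ?c = "\<lambda>j. if j = i then 1 else 0"
    have l: "\<not> eq l (\<lambda>_. 0)"
      using le_0 h(5) k by blast
    have val: "coeff_functional R k l ?c 2 (Ymon R m * (zv i' * Ymon R n) :: 'k free_jordan) =
        ?c i' / 4 * ((if eq k m \<and> eq l n then 1 else 0) + (if eq k n \<and> eq l m then 1 else 0))"
      if "bd m" "bd n" for m n i'
    proof -
      have mn: "\<forall>j<R. m j < CARD('k)" "\<forall>j<R. n j < CARD('k)"
        using that by (simp_all add: bd_def)
      show ?thesis
        unfolding coeff_functional_YzY(2)[OF mn] eq_def[symmetric] using k l by simp
    qed
    show "coeff_functional R k l ?c 2 h \<noteq> 0"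
      unfolding h(2) val[OF h(3,4)] using two four by simp
    show "a h' = 0 \<or> coeff_functional R k l ?c 2 h' = 0" if "h' \<in> F" "h' \<noteq> h" for h'
      using that(1)
    proof (rule cases_F)
      fix m n i' assume mn: "bd m" "bd n" "le m n" "h' = Ymon R m * (zv i' * Ymon R n)"
      have "\<not> (eq k m \<and> eq l n)" if "i' = i"
        using \<open>h' \<noteq> h\<close> eq_Ymon that mn(4) h(2) by metis
      \<comment> \<open>The reversed match would put \<open>l\<close> before \<open>k\<close> as
        well; antisymmetry then makes them agree, and it is the direct match.\<close>
      moreover have "eq k m \<and> eq l n" if "eq k n" "eq l m"
      proof -
        have "le l k"
          using le_eq that mn(3) by blast
        then have "eq k l"
          using le_antisym h(5) by blast
        then show ?thesis
          using that eq_sym eq_trans by blast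
      qed
      ultimately show ?thesis
        unfolding mn(4) val[OF mn(1,2)] by auto
    qed (simp add: coeff_functional_Ymon(2) bd_def)
  qed
  note YzY_zero = this
  \<comment> \<open>Third stage: the coefficient of \<open>x^l\<close> alone is used. Elements with
    nonzero first exponent may contribute, but the second stage has removed their
    coefficients.\<close>
  have "a h = 0" if h: "h \<in> F" "h = Ymon R k * (zv i * Ymon R l)" "bd k" "bd l"
    and k: "eq k (\<lambda>_. 0)" for h k l i
  proof (rule isolate[OF h(1)])
    let ?c = "\<lambda>j. if j = i then 1 else 0"
    \<comment> \<open>For \<open>m = 0\<close> the product is \<open>2 (x^n + y^n)\<close>: the
      coefficient of \<open>x^l\<close> at \<open>n = l\<close> is 2, or 4 when \<open>l = 0\<close>
      merges both terms.\<close>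
    have val: "coeff_functional R l (\<lambda>_. 0) ?c 2 (Ymon R m * (zv i' * Ymon R n) :: 'k free_jordan) =
        ?c i' / 4 * (if eq l n then if eq l (\<lambda>_. 0) then 4 else 2 else 0)"
      if "bd m" "bd n" "eq m (\<lambda>_. 0)" for m n i'
    proof -
      have mn: "\<forall>j<R. m j < CARD('k)" "\<forall>j<R. n j < CARD('k)"
        using that by (simp_all add: bd_def)
      have "eq (\<lambda>_. 0) m"
        using that(3) eq_sym by blast
      have "Ypow R (\<lambda>j. m j + n j) x = Ypow R n x" for x :: "nat \<Rightarrow> 'k"
        using that(3) by (simp add: Ypow_def eq_def)
      then have sum_eq: "(\<Sum>x\<in>points R. Yweight R k x * Ypow R (\<lambda>j. m j + n j) x :: 'k) =
          (\<Sum>x\<in>points R. Yweight R k x * Ypow R n x)" for k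
        by simp
      have "coeff_functional R l (\<lambda>_. 0) ?c 2
          (Ymon R m * (zv i' * Ymon R n) :: 'k free_jordan) = ?c i' / 4 *
          ((if eq l n then 1 else 0) + (if eq l m \<and> eq (\<lambda>_. 0) n then 1 else 0) +
           (if eq l n then 1 else 0) + (if eq l (\<lambda>_. 0) \<and> eq (\<lambda>_. 0) n then 1 else 0))"
        unfolding coeff_functional_YzY(2)[OF mn] sum_eq sum_Yweight_Ypow[OF mn(2)] eq_def[symmetric]
        using \<open>eq (\<lambda>_. 0) m\<close> by simp
      moreover have "eq l m \<and> eq (\<lambda>_. 0) n \<longleftrightarrow> eq l n \<and> eq l (\<lambda>_. 0)"
        "eq l (\<lambda>_. 0) \<and> eq (\<lambda>_. 0) n \<longleftrightarrow> eq l n \<and> eq l (\<lambda>_. 0)"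
        using that(3) by (auto simp: eq_def)
      ultimately show ?thesis by simp
    qed
    show "coeff_functional R l (\<lambda>_. 0) ?c 2 h \<noteq> 0"
      unfolding h(2) val[OF h(3,4) k] using two four by simp
    show "a h' = 0 \<or> coeff_functional R l (\<lambda>_. 0) ?c 2 h' = 0" if "h' \<in> F" "h' \<noteq> h" for h'
      using that(1)
    proof (rule cases_F)
      fix m n i' assume mn: "bd m" "bd n" "le m n" "h' = Ymon R m * (zv i' * Ymon R n)"
      show ?thesis
      proof (cases "eq m (\<lambda>_. 0)")
        case True
        then have "eq k m"
          using k eq_sym eq_trans by blast
        then have "\<not> eq l n" if "i' = i"
          using \<open>h' \<noteq> h\<close> eq_Ymon that mn(4) h(2) by metis
        then show ?thesis
          unfolding mn(4) val[OF mn(1,2) True] by auto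
      qed (use YzY_zero \<open>h' \<in> F\<close> mn in blast)
    qed (simp add: coeff_functional_Ymon(2) bd_def)
  qed
  note zY_zero = this
  show ?thesis
    using \<open>g \<in> F\<close>
  proof (rule cases_F)
    show "a g = 0" if "bd m" "g = Ymon R m" for m
      using Y_zero[OF \<open>g \<in> F\<close> that(2,1)] .
    show "a g = 0" if "bd m" "bd n" "le m n" "g = Ymon R m * (zv i * Ymon R n)" for m n i
      using YzY_zero[OF \<open>g \<in> F\<close> that(4,1,2,3)] zY_zero[OF \<open>g \<in> F\<close> that(4,1,2)]
      by (cases "eq m (\<lambda>_. 0)") simp_all
  qed
qed

end

section \<open>From independence modulo identities to the basis and the equality of ideals\<close>

lemma cosetI_sum: "cosetI (\<Sum>g\<in>F. a g *J g) = (\<Sum>g\<in>F. scaleQ (a g) (cosetI g))"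
  by (induction F rule: infinite_finite_induct)
    (simp_all flip: zero_J_mod_I'.abs_eq plus_J_mod_I'.abs_eq scaleQ.abs_eq)

theorem theorem5p11:
  assumes "CHAR('k::{field,finite}) \<noteq> 2"
  shows "(I' :: 'k free_jordan set) = T_Cla \<and>
    inj_on cosetI (S_hat :: 'k free_jordan set) \<and>
    Q.independent (cosetI ` (S_hat :: 'k free_jordan set)) \<and>
    Q.span (cosetI ` (S_hat :: 'k free_jordan set)) = UNIV"
proof -
  note two = two_ne_0[OF assms]
  note indep = S_hat_independent_mod_T_Cla[OF two]
  have sub: "(I' :: 'k free_jordan set) \<subseteq> T_Cla"
    by (rule I'_subset_T_Cla[OF two])
  \<comment> \<open>Distinct elements with equal cosets would merge in the image set, so this is a
    separate part of being a basis.\<close>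
  have inj: "inj_on cosetI (S_hat :: 'k free_jordan set)"
  proof (rule inj_onI, rule ccontr)
    fix g h :: "'k free_jordan"
    assume gh: "g \<in> S_hat" "h \<in> S_hat" "cosetI g = cosetI h" "g \<noteq> h"
    then have "g - h \<in> T_Cla"
      using sub by (auto simp: cosetI_eq_iff)
    \<comment> \<open>The difference \<open>g - h\<close> as a combination with coefficients 1 and
      -1.\<close>
    then have "(\<Sum>x\<in>{g, h}. (if x = g then 1 else - 1) *J x) \<in> T_Cla"
      using gh(4) by (simp add: FJ.scale_minus_left)
    from indep[OF _ _ this, of g] show False
      using gh(1,2) by simp
  qed
  moreover have "Q.independent (cosetI ` (S_hat :: 'k free_jordan set))"
    unfolding Q.dependent_explicit
  proof (intro notI, elim exE conjE bexE)
    fix t u v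
    assume t: "finite t" "t \<subseteq> cosetI ` (S_hat :: 'k free_jordan set)"
      "(\<Sum>v\<in>t. scaleQ (u v) v) = 0" "v \<in> t" "u v \<noteq> 0"
    \<comment> \<open>A finite set of cosets is lifted to representatives; injectivity lets the sums
      be reindexed.\<close>
    obtain F where F: "F \<subseteq> S_hat" "finite F" "t = cosetI ` F"
      using finite_subset_image[OF t(1,2)] by blast
    have "cosetI (\<Sum>g\<in>F. u (cosetI g) *J g) = cosetI 0"
      using t(3) unfolding F(3) sum.reindex[OF inj_on_subset[OF inj F(1)]]
      by (simp add: cosetI_sum zero_J_mod_I'.abs_eq)
    then have "(\<Sum>g\<in>F. u (cosetI g) *J g) \<in> T_Cla"
      using sub by (auto simp: cosetI_eq_iff)
    with indep[OF F(2,1), of "\<lambda>g. u (cosetI g)"] t(4,5) show False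
      unfolding F(3) by blast
  qed
  moreover have span: "Q.span (cosetI ` (S_hat :: 'k free_jordan set)) = UNIV"
    by (rule span_S_hat[OF assms])
  moreover have "T_Cla \<subseteq> (I' :: 'k free_jordan set)"
  proof
    fix f :: "'k free_jordan"
    assume f: "f \<in> T_Cla"
    obtain t u where t: "finite t" "t \<subseteq> cosetI ` S_hat" "cosetI f = (\<Sum>v\<in>t. scaleQ (u v) v)"
      using span[THEN equalityD2, THEN subsetD, OF UNIV_I[of "cosetI f"]]
      unfolding Q.span_explicit by blast
    obtain F where F: "F \<subseteq> S_hat" "finite F" "t = cosetI ` F"
      using finite_subset_image[OF t(1,2)] by blast
    \<comment> \<open>The combination \<open>s\<close> represents \<open>f\<close> modulo
      \<open>I'\<close>. It is an identity because \<open>f\<close> and \<open>f - s\<close> are, so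
      its coefficients vanish and \<open>f\<close> lies in \<open>I'\<close>.\<close>
    define s where "s = (\<Sum>g\<in>F. u (cosetI g) *J g)"
    have "cosetI f = cosetI s"
      unfolding t(3) F(3) sum.reindex[OF inj_on_subset[OF inj F(1)]] s_def
      by (simp add: cosetI_sum)
    then have fs: "f - s \<in> I'"
      by (simp add: cosetI_eq_iff)
    have "FJ.subspace (T_Cla :: 'k free_jordan set)"
      using T2_ideal_T_Cla[OF two] by (simp add: T2_ideal_def J_ideal_def)
    from FJ.subspace_diff[OF this f, of "f - s"] have "s \<in> T_Cla"
      using fs sub by auto
    then have "u (cosetI g) = 0" if "g \<in> F" for g
      using indep[OF F(2,1), of "\<lambda>g. u (cosetI g)"] that unfolding s_def by blast
    then have "s = 0"
      by (simp add: s_def)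
    with fs show "f \<in> I'"
      by simp
  qed
  ultimately show ?thesis
    using sub by blast
qed

end
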